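(* Let $X,Y$ be shift-homogeneous boundedly-finite metric spaces. Then $X$ and $Y$ are coarsely equivalent if and only if their factorizing components $X_{s(X)}$ and $Y_{s(Y)}$ are coarsely equivalent and the spaces $X,Y$ either both are large scale connected or both are not large scale connected.
   Context: Metric spaces are nonempty; subsets carry the restricted metric. A map $f:X\to Y$ between metric spaces is coarse if for each finite $\delta\ge 0$ the oscillation $\omega_f(\delta)=\sup\{d_Y(f(x),f(x')):x,x'\in X,\ d_X(x,x')\le\delta\}$ is finite. It is a coarse equivalence if it is coarse and there is a coarse map $g:Y\to X$ with $\sup_{x\in X}d_X(x,g(f(x)))<\infty$ and $\sup_{y\in Y}d_Y(y,f(g(y)))<\infty$. Two spaces are coarsely equivalent if there is a coarse equivalence between them. A metric space is boundedly-finite if each of its bounded subsets is finite. For a real $\varepsilon\ge0$, a subset $C\subset X$ is $\varepsilon$-connected if any two points $x,y\in C$ can be linked by points $x=x_0,x_1,\dots,x_n=y$ of $C$ with $d_X(x_{i-1},x_i)\le\varepsilon$ for all $1\le i\le n$. The $\varepsilon$-connected component $X_\varepsilon(x)$ of $x\in X$ is the maximal $\varepsilon$-connected subset of $X$ containing $x$; also $X_\infty(x)=X$. A metric space (or subset) is large scale connected if it is $\varepsilon$-connected for some $\varepsilon<\infty$. A metric space $X$ is shift-homogeneous if for any $x,y\in X$ there is a bijective isometry $f:X\to X$ such that $f(x)=y$ and $\sup_{c\in C}d_X(f(c),c)<\infty$ for every large scale connected subset $C\subset X$. The factorizing step of $X$ is $s(X)=\inf\big(\{\infty\}\cup\{\varepsilon\in[0,\infty):$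 for all $\delta\in[\varepsilon,\infty)$ and all $x\in X$ the set $\{X_\varepsilon(y):y\in X_\delta(x)\}$ is finite$\}\big)$. For a shift-homogeneous (hence homogeneous) $X$, all $s(X)$-connected components of $X$ are pairwise isometric; the factorizing component $X_{s(X)}$ is any one of them. *)

theory Defs
  imports "HOL-Analysis.Analysis"
begin

text \<open>
  A metric space is given by a carrier and a distance satisfying \<^locale>\<open>Metric_space\<close>;
  a subset \<open>C \<subseteq> X\<close> of \<open>(X, d)\<close> with the restricted metric is then just \<open>(C, d)\<close>.
  Suprema of distances are taken in \<^typ>\<open>ereal\<close>, so that finiteness of a supremum is
  expressible literally.
\<close>

definition oscillation ::
  "'a set \<Rightarrow> ('a \<Rightarrow> 'a \<Rightarrow> real) \<Rightarrow> ('b \<Rightarrow> 'b \<Rightarrow> real) \<Rightarrow> ('a \<Rightarrow> 'b) \<Rightarrow> real \<Rightarrow> ereal" where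
  "oscillation X dX dY f \<delta> =
     Sup {ereal (dY (f x) (f x')) | x x'. x \<in> X \<and> x' \<in> X \<and> dX x x' \<le> \<delta>}"

definition coarse_map ::
  "'a set \<Rightarrow> ('a \<Rightarrow> 'a \<Rightarrow> real) \<Rightarrow> 'b set \<Rightarrow> ('b \<Rightarrow> 'b \<Rightarrow> real) \<Rightarrow> ('a \<Rightarrow> 'b) \<Rightarrow> bool" where
  "coarse_map X dX Y dY f \<longleftrightarrow>
     f \<in> X \<rightarrow> Y \<and> (\<forall>\<delta>\<ge>0. oscillation X dX dY f \<delta> < \<infinity>)"

definition coarse_equivalence ::
  "'a set \<Rightarrow> ('a \<Rightarrow> 'a \<Rightarrow> real) \<Rightarrow> 'b set \<Rightarrow> ('b \<Rightarrow> 'b \<Rightarrow> real) \<Rightarrow> ('a \<Rightarrow> 'b) \<Rightarrow> bool" where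
  "coarse_equivalence X dX Y dY f \<longleftrightarrow>
     coarse_map X dX Y dY f \<and>
     (\<exists>g. coarse_map Y dY X dX g \<and>
          (SUP x\<in>X. ereal (dX x (g (f x)))) < \<infinity> \<and>
          (SUP y\<in>Y. ereal (dY y (f (g y)))) < \<infinity>)"

definition coarsely_equivalent ::
  "'a set \<Rightarrow> ('a \<Rightarrow> 'a \<Rightarrow> real) \<Rightarrow> 'b set \<Rightarrow> ('b \<Rightarrow> 'b \<Rightarrow> real) \<Rightarrow> bool" where
  "coarsely_equivalent X dX Y dY \<longleftrightarrow> (\<exists>f. coarse_equivalence X dX Y dY f)"

definition boundedly_finite :: "'a set \<Rightarrow> ('a \<Rightarrow> 'a \<Rightarrow> real) \<Rightarrow> bool" where
  "boundedly_finite X d \<longleftrightarrow> (\<forall>B. Metric_space.mbounded X d B \<longrightarrow> finite B)"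

definition eps_connected :: "('a \<Rightarrow> 'a \<Rightarrow> real) \<Rightarrow> real \<Rightarrow> 'a set \<Rightarrow> bool" where
  "eps_connected d \<epsilon> C \<longleftrightarrow>
     (\<forall>x\<in>C. \<forall>y\<in>C. \<exists>n (z::nat \<Rightarrow> 'a).
        z 0 = x \<and> z n = y \<and> (\<forall>i\<le>n. z i \<in> C) \<and> (\<forall>i\<in>{1..n}. d (z (i - 1)) (z i) \<le> \<epsilon>))"

text \<open>
  The maximal \<open>\<epsilon>\<close>-connected subset containing \<open>x\<close> is the greatest one with respect to
  inclusion; \<open>eps_component_greatest\<close> below shows that it exists.
\<close>

definition eps_component :: "'a set \<Rightarrow> ('a \<Rightarrow> 'a \<Rightarrow> real) \<Rightarrow> ereal \<Rightarrow> 'a \<Rightarrow> 'a set" where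
  "eps_component X d \<epsilon> x =
     (if \<epsilon> = \<infinity> then X
      else (GREATEST C. C \<subseteq> X \<and> x \<in> C \<and> eps_connected d (real_of_ereal \<epsilon>) C))"

lemma eps_connected_chain_append:
  fixes z w :: "nat \<Rightarrow> 'a"
  assumes "\<forall>i\<le>m. z i \<in> C" "\<forall>i\<in>{1..m}. d (z (i - 1)) (z i) \<le> \<epsilon>" "z m = w 0"
    and "\<forall>i\<le>n. w i \<in> D" "\<forall>i\<in>{1..n}. d (w (i - 1)) (w i) \<le> \<epsilon>"
  shows "\<exists>u. u 0 = z 0 \<and> u (m + n) = w n \<and> (\<forall>i\<le>m + n. u i \<in> C \<union> D) \<and>
             (\<forall>i\<in>{1..m + n}. d (u (i - 1)) (u i) \<le> \<epsilon>)"
proof -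
  define u where "u i = (if i \<le> m then z i else w (i - m))" for i
  have "d (u (i - 1)) (u i) \<le> \<epsilon>" if i: "i \<in> {1..m + n}" for i
  proof (cases "i \<le> m")
    case True
    then show ?thesis using assms(2) i by (auto simp: u_def)
  next
    case False
    then have "u (i - 1) = w (i - m - 1)"
      using assms(3) by (cases "i = Suc m") (auto simp: u_def)
    moreover have "u i = w (i - m)" using False by (simp add: u_def)
    moreover have "i - m \<in> {1..n}" using False i by auto
    moreover from this have "d (w (i - m - 1)) (w (i - m)) \<le> \<epsilon>"
      using assms(5) by blast
    ultimately show ?thesis by simp
  qed
  moreover have "u 0 = z 0" "u (m + n) = w n" using assms(3) by (auto simp: u_def)
  moreover have "u i \<in> C \<union> D" if "i \<le> m + n" for i
    using assms(1,4) that by (auto simp: u_def)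
  ultimately show ?thesis by blast
qed

lemma eps_component_greatest:
  fixes \<epsilon> :: real
  assumes "x \<in> X"
  shows "eps_component X d (ereal \<epsilon>) x \<subseteq> X"
    and "x \<in> eps_component X d (ereal \<epsilon>) x"
    and "eps_connected d \<epsilon> (eps_component X d (ereal \<epsilon>) x)"
    and "\<And>C. C \<subseteq> X \<Longrightarrow> x \<in> C \<Longrightarrow> eps_connected d \<epsilon> C \<Longrightarrow> C \<subseteq> eps_component X d (ereal \<epsilon>) x"
proof -
  define P where "P C \<longleftrightarrow> C \<subseteq> X \<and> x \<in> C \<and> eps_connected d \<epsilon> C" for C
  define U where "U = \<Union>{C. P C}"
  have "\<exists>n (z::nat \<Rightarrow> 'a). z 0 = x \<and> z n = x \<and> (\<forall>i\<le>n. z i \<in> {x}) \<and>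
      (\<forall>i\<in>{1..n}. d (z (i - 1)) (z i) \<le> \<epsilon>)"
    by (rule exI[of _ 0], rule exI[of _ "\<lambda>_. x"]) simp
  then have "eps_connected d \<epsilon> {x}"
    unfolding eps_connected_def by blast
  then have "P {x}" using assms unfolding P_def by blast
  then have xU: "x \<in> U" by (auto simp: U_def)
  have conn: "\<exists>n (z::nat \<Rightarrow> 'a). z 0 = a \<and> z n = b \<and> (\<forall>i\<le>n. z i \<in> C) \<and>
      (\<forall>i\<in>{1..n}. d (z (i - 1)) (z i) \<le> \<epsilon>)" 
    if "P C" "a \<in> C" "b \<in> C" for C a b
  proof -
    have "eps_connected d \<epsilon> C" using that(1) unfolding P_def by blast
    from this[unfolded eps_connected_def, rule_format, OF that(2,3)] show ?thesis .
  qed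
  have "eps_connected d \<epsilon> U"
    unfolding eps_connected_def
  proof (intro ballI)
    fix a b assume "a \<in> U" "b \<in> U"
    then obtain A B where A: "P A" "a \<in> A" and B: "P B" "b \<in> B" by (auto simp: U_def)
    have xA: "x \<in> A" and xB: "x \<in> B" using A B by (simp_all add: P_def)
    obtain m :: nat and z where z: "z 0 = a" "z m = x" "\<forall>i\<le>m. z i \<in> A"
        "\<forall>i\<in>{1..m}. d (z (i - 1)) (z i) \<le> \<epsilon>"
      using conn[OF A xA] by blast
    obtain n :: nat and w where w: "w 0 = x" "w n = b" "\<forall>i\<le>n. w i \<in> B"
        "\<forall>i\<in>{1..n}. d (w (i - 1)) (w i) \<le> \<epsilon>"
      using conn[OF B(1) xB B(2)] by blast
    have "z m = w 0" using z(2) w(1) by simp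
    from eps_connected_chain_append[OF z(3,4) this w(3,4)] obtain u where u:
      "u 0 = z 0" "u (m + n) = w n" "\<forall>i\<le>m + n. u i \<in> A \<union> B"
      "\<forall>i\<in>{1..m + n}. d (u (i - 1)) (u i) \<le> \<epsilon>"
      by blast
    have "A \<union> B \<subseteq> U" using A B by (auto simp: U_def)
    then have "\<forall>i\<le>m + n. u i \<in> U" using u(3) by blast
    then show "\<exists>n (z::nat \<Rightarrow> 'a). z 0 = a \<and> z n = b \<and> (\<forall>i\<le>n. z i \<in> U) \<and>
        (\<forall>i\<in>{1..n}. d (z (i - 1)) (z i) \<le> \<epsilon>)"
      using u(1,2,4) z(1) w(2) by (intro exI[of _ "m + n"] exI[of _ u]) simp
  qed
  then have PU: "P U" using xU by (auto simp: P_def U_def)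
  have le: "C \<subseteq> U" if "P C" for C using that by (auto simp: U_def)
  have "(GREATEST C. P C) = U" by (rule Greatest_equality) (use PU le in auto)
  then have eq: "eps_component X d (ereal \<epsilon>) x = U"
    by (simp add: eps_component_def P_def)
  show "eps_component X d (ereal \<epsilon>) x \<subseteq> X" "x \<in> eps_component X d (ereal \<epsilon>) x"
    "eps_connected d \<epsilon> (eps_component X d (ereal \<epsilon>) x)"
    using PU by (simp_all add: eq P_def)
  show "C \<subseteq> eps_component X d (ereal \<epsilon>) x" if "C \<subseteq> X" "x \<in> C" "eps_connected d \<epsilon> C" for C
    using le that by (simp add: eq P_def)
qed

definition large_scale_connected :: "('a \<Rightarrow> 'a \<Rightarrow> real) \<Rightarrow> 'a set \<Rightarrow> bool" where
  "large_scale_connected d C \<longleftrightarrow> (\<exists>\<epsilon>\<ge>0. eps_connected d \<epsilon> C)"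

definition shift_homogeneous :: "'a set \<Rightarrow> ('a \<Rightarrow> 'a \<Rightarrow> real) \<Rightarrow> bool" where
  "shift_homogeneous X d \<longleftrightarrow>
     (\<forall>x\<in>X. \<forall>y\<in>X. \<exists>f. bij_betw f X X \<and> (\<forall>a\<in>X. \<forall>b\<in>X. d (f a) (f b) = d a b) \<and> f x = y \<and>
        (\<forall>C\<subseteq>X. large_scale_connected d C \<longrightarrow> (SUP c\<in>C. ereal (d (f c) c)) < \<infinity>))"

definition factorizing_step :: "'a set \<Rightarrow> ('a \<Rightarrow> 'a \<Rightarrow> real) \<Rightarrow> ereal" where
  "factorizing_step X d =
     Inf ({\<infinity>} \<union> {ereal \<epsilon> | \<epsilon>. \<epsilon> \<ge> 0 \<and>
       (\<forall>\<delta>\<ge>\<epsilon>. \<forall>x\<in>X. finite {eps_component X d (ereal \<epsilon>) y | y. y \<in> eps_component X d (ereal \<delta>) x})})"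

definition factorizing_component :: "'a set \<Rightarrow> ('a \<Rightarrow> 'a \<Rightarrow> real) \<Rightarrow> 'a set \<Rightarrow> bool" where
  "factorizing_component X d C \<longleftrightarrow> (\<exists>x\<in>X. C = eps_component X d (factorizing_step X d) x)"

end

theory Submission
  imports Defs
begin

text \<open>
  Why the theorem is true.  Write \<open>X\<^sub>e\<close> for an \<open>e\<close>-component and call a real \<open>e\<close> factorizing if it
  belongs to the set whose infimum is the factorizing step: every larger component is a finite union
  of \<open>e\<close>-components.  If no \<open>e\<close> is factorizing, the factorizing component is the whole space;
  otherwise, because distances in a homogeneous boundedly-finite space form a locally finite set,
  it is \<open>X\<^sub>e\<close> for some factorizing \<open>e\<close> (\<open>factorizing_component_cases\<close>).  Shift-homogeneity says that
  the isometry carrying one \<open>e\<close>-component to another moves it by a bounded amount.  Hence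
  \<open>X\<^sub>e\<close> is coarsely dense in any larger component that contains it (\<open>component_dense\<close>), and the
  coarse type of \<open>X\<^sub>e\<close> does not depend on the factorizing \<open>e\<close> (\<open>components_corresponding\<close>).

  A coarse equivalence carries components into components of a comparable scale in both directions,
  so it preserves large scale connectedness, the existence of a factorizing scale, and
  the coarse type of the components at such scales (\<open>component_transfer\<close>).  This gives the
  implication from left to right.

  Conversely, a large scale connected space is coarsely equivalent to its factorizing component,
  by coarse density.  Now suppose that neither space is large scale connected.  The component at a
  factorizing scale is large scale connected, so if the factorizing components are coarsely
  equivalent and one space has no factorizing scale, neither has the other, and both components are
  the spaces themselves.  The remaining case carries the weight.  Going up through the scales
  \<open>e\<close>, \<open>e + 1\<close>, \<open>e + 2\<close>, \<dots> and choosing shift isometries onto the finitely many components at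
  each level that lie in a fixed component of the next level, every point gets a coordinate in
  \<open>X\<^sub>e\<close> together with a sequence of digits, that is, a natural number in a mixed radix
  system.  This makes \<open>X\<close> coarsely equivalent to \<open>X\<^sub>e \<times> \<nat>\<close>, where \<open>\<nat>\<close> has the ultrametric of
  nested blocks (\<open>product_decomposition\<close>).  Finally any two such ultrametrics on \<open>\<nat>\<close> are coarsely
  equivalent (\<open>block_scales_corresponding\<close>): blocks of one ultrametric can be interleaved with
  blocks of the other in a common tower of surjections \<open>\<nat> \<rightarrow> \<nat> \<rightarrow> \<nat> \<rightarrow> \<dots>\<close> in which two consecutive maps
  always compose to an exact division.

  Coarse equivalences are handled as relations with full projections that are controlled in both
  directions.  Such relations are symmetric and compose without any choice of quasi-inverses.
\<close>

section \<open>Coarse correspondences\<close>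

definition controlled ::
  "('a \<Rightarrow> 'a \<Rightarrow> real) \<Rightarrow> ('b \<Rightarrow> 'b \<Rightarrow> real) \<Rightarrow> ('a \<times> 'b) set \<Rightarrow> bool" where
  "controlled dX dY R \<longleftrightarrow>
     (\<forall>\<delta>. \<exists>\<eta>. \<forall>x y x' y'. (x, y) \<in> R \<longrightarrow> (x', y') \<in> R \<longrightarrow> dX x x' \<le> \<delta> \<longrightarrow> dY y y' \<le> \<eta>)"

definition coarse_correspondence ::
  "'a set \<Rightarrow> ('a \<Rightarrow> 'a \<Rightarrow> real) \<Rightarrow> 'b set \<Rightarrow> ('b \<Rightarrow> 'b \<Rightarrow> real) \<Rightarrow> ('a \<times> 'b) set \<Rightarrow> bool" where
  "coarse_correspondence X dX Y dY R \<longleftrightarrow>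
     Domain R = X \<and> Range R = Y \<and> controlled dX dY R \<and> controlled dY dX (R\<inverse>)"

text \<open>
  The distances are arbitrary functions here, which lets the product of a component with a block
  distance on \<open>\<nat>\<close> serve as an intermediate space between \<open>X\<close> and \<open>Y\<close>.
\<close>

definition corresponding ::
  "'a set \<Rightarrow> ('a \<Rightarrow> 'a \<Rightarrow> real) \<Rightarrow> 'b set \<Rightarrow> ('b \<Rightarrow> 'b \<Rightarrow> real) \<Rightarrow> bool" where
  "corresponding X dX Y dY \<longleftrightarrow> (\<exists>R. coarse_correspondence X dX Y dY R)"

lemma controlledI:
  assumes "\<And>\<delta>. \<exists>\<eta>. \<forall>x y x' y'. (x, y) \<in> R \<longrightarrow> (x', y') \<in> R \<longrightarrow> dX x x' \<le> \<delta> \<longrightarrow> dY y y' \<le> \<eta>"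
  shows "controlled dX dY R"
  using assms unfolding controlled_def by blast

lemma controlledE:
  assumes "controlled dX dY R"
  obtains \<eta> where
    "\<And>x y x' y'. \<lbrakk>(x, y) \<in> R; (x', y') \<in> R; dX x x' \<le> \<delta>\<rbrakk> \<Longrightarrow> dY y y' \<le> \<eta>"
  using assms unfolding controlled_def by meson

lemma controlled_comp:
  assumes "controlled dX dY R" "controlled dY dZ S"
  shows "controlled dX dZ (R O S)"
proof (rule controlledI)
  fix \<delta>
  obtain \<eta> where \<eta>: "\<And>x y x' y'. \<lbrakk>(x, y) \<in> R; (x', y') \<in> R; dX x x' \<le> \<delta>\<rbrakk> \<Longrightarrow> dY y y' \<le> \<eta>"
    using controlledE[OF assms(1)] by metis
  obtain \<theta> where \<theta>: "\<And>x y x' y'. \<lbrakk>(x, y) \<in> S; (x', y') \<in> S; dY x x' \<le> \<eta>\<rbrakk> \<Longrightarrow> dZ y y' \<le> \<theta>"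
    using controlledE[OF assms(2)] by metis
  show "\<exists>\<eta>. \<forall>x y x' y'. (x, y) \<in> R O S \<longrightarrow> (x', y') \<in> R O S \<longrightarrow> dX x x' \<le> \<delta> \<longrightarrow> dZ y y' \<le> \<eta>"
    using \<eta> \<theta> by (intro exI[of _ \<theta>]) blast
qed

lemma corresponding_trans:
  assumes "corresponding X dX Y dY" "corresponding Y dY Z dZ"
  shows "corresponding X dX Z dZ"
proof -
  obtain R S where R: "coarse_correspondence X dX Y dY R" and S: "coarse_correspondence Y dY Z dZ S"
    using assms by (auto simp: corresponding_def)
  have "Domain (R O S) = X" "Range (R O S) = Z"
    using R S unfolding coarse_correspondence_def by blast+
  then have "coarse_correspondence X dX Z dZ (R O S)"
    using R S by (auto simp: coarse_correspondence_def converse_relcomp intro: controlled_comp)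
  then show ?thesis by (auto simp: corresponding_def)
qed

lemma corresponding_sym:
  assumes "corresponding X dX Y dY"
  shows "corresponding Y dY X dX"
proof -
  obtain R where "coarse_correspondence X dX Y dY R"
    using assms by (auto simp: corresponding_def)
  then have "coarse_correspondence Y dY X dX (R\<inverse>)"
    by (auto simp: coarse_correspondence_def)
  then show ?thesis by (auto simp: corresponding_def)
qed

definition max_dist ::
  "('a \<Rightarrow> 'a \<Rightarrow> real) \<Rightarrow> ('b \<Rightarrow> 'b \<Rightarrow> real) \<Rightarrow> 'a \<times> 'b \<Rightarrow> 'a \<times> 'b \<Rightarrow> real" where
  "max_dist dA dB p q = max (dA (fst p) (fst q)) (dB (snd p) (snd q))"

definition rel_times :: "('a \<times> 'b) set \<Rightarrow> ('c \<times> 'd) set \<Rightarrow> (('a \<times> 'c) \<times> ('b \<times> 'd)) set" where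
  "rel_times R S = {((a, c), (b, d)) | a b c d. (a, b) \<in> R \<and> (c, d) \<in> S}"

lemma controlled_rel_times:
  assumes "controlled dA dB R" "controlled dC dD S"
  shows "controlled (max_dist dA dC) (max_dist dB dD) (rel_times R S)"
proof (rule controlledI)
  fix \<delta>
  obtain \<eta> where \<eta>: "\<And>x y x' y'. \<lbrakk>(x, y) \<in> R; (x', y') \<in> R; dA x x' \<le> \<delta>\<rbrakk> \<Longrightarrow> dB y y' \<le> \<eta>"
    using controlledE[OF assms(1)] by metis
  obtain \<theta> where \<theta>: "\<And>x y x' y'. \<lbrakk>(x, y) \<in> S; (x', y') \<in> S; dC x x' \<le> \<delta>\<rbrakk> \<Longrightarrow> dD y y' \<le> \<theta>"
    using controlledE[OF assms(2)] by metis
  show "\<exists>\<eta>. \<forall>x y x' y'. (x, y) \<in> rel_times R S \<longrightarrow> (x', y') \<in> rel_times R S \<longrightarrow>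
      max_dist dA dC x x' \<le> \<delta> \<longrightarrow> max_dist dB dD y y' \<le> \<eta>"
    using \<eta> \<theta> 
    by (intro exI[of _ "max \<eta> \<theta>"])
      (simp add: max_dist_def rel_times_def, blast intro: max.coboundedI1 max.coboundedI2)
qed

lemma corresponding_times:
  assumes "corresponding A dA B dB" "corresponding C dC D dD"
  shows "corresponding (A \<times> C) (max_dist dA dC) (B \<times> D) (max_dist dB dD)"
proof -
  obtain R S where R: "coarse_correspondence A dA B dB R" and S: "coarse_correspondence C dC D dD S"
    using assms by (auto simp: corresponding_def)
  have conv: "(rel_times R S)\<inverse> = rel_times (R\<inverse>) (S\<inverse>)"
    by (auto simp: rel_times_def)
  have "Domain (rel_times R S) = Domain R \<times> Domain S" "Range (rel_times R S) = Range R \<times> Range S"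
    by (auto simp: rel_times_def Domain_iff Range_iff)
  then have "coarse_correspondence (A \<times> C) (max_dist dA dC) (B \<times> D) (max_dist dB dD) (rel_times R S)"
    using R S by (simp add: coarse_correspondence_def conv controlled_rel_times)
  then show ?thesis by (auto simp: corresponding_def)
qed

lemma Sup_ereal_less_PInf_iff:
  fixes S :: "ereal set"
  shows "Sup S < \<infinity> \<longleftrightarrow> (\<exists>K::real. \<forall>s\<in>S. s \<le> ereal K)"
proof
  assume "Sup S < \<infinity>"
  then obtain K where "Sup S < ereal K" using ereal_dense2 by blast
  then show "\<exists>K::real. \<forall>s\<in>S. s \<le> ereal K"
    by (meson Sup_upper less_imp_le order_trans)
next
  assume "\<exists>K::real. \<forall>s\<in>S. s \<le> ereal K"
  then obtain K where "\<forall>s\<in>S. s \<le> ereal K" ..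
  then have "Sup S \<le> ereal K" by (simp add: Sup_least)
  then show "Sup S < \<infinity>" by (rule order_le_less_trans) simp
qed

lemma SUP_ereal_less_PInf_iff:
  "(SUP x\<in>X. ereal (f x)) < \<infinity> \<longleftrightarrow> (\<exists>K. \<forall>x\<in>X. f x \<le> K)"
  unfolding Sup_ereal_less_PInf_iff by simp

lemma coarse_map_iff:
  "coarse_map X dX Y dY f \<longleftrightarrow> f \<in> X \<rightarrow> Y \<and>
     (\<forall>\<delta>\<ge>0. \<exists>K. \<forall>x\<in>X. \<forall>x'\<in>X. dX x x' \<le> \<delta> \<longrightarrow> dY (f x) (f x') \<le> K)"
proof -
  have "oscillation X dX dY f \<delta> < \<infinity> \<longleftrightarrow>
      (\<exists>K. \<forall>x\<in>X. \<forall>x'\<in>X. dX x x' \<le> \<delta> \<longrightarrow> dY (f x) (f x') \<le> K)" for \<delta>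
    unfolding oscillation_def Sup_ereal_less_PInf_iff by (rule ex_cong1) fastforce
  then show ?thesis unfolding coarse_map_def by blast
qed

text \<open>
  Choice functions of the relation and of its converse are the two maps.  A point \<open>x\<close> and its
  image \<open>g (f x)\<close> are both related to \<open>f x\<close>, and two points related to the same point are
  uniformly close, since the relation is controlled at scale \<open>0\<close>.
\<close>

lemma coarsely_equivalent_if_corresponding:
  assumes X: "Metric_space X dX" and Y: "Metric_space Y dY"
    and "corresponding X dX Y dY"
  shows "coarsely_equivalent X dX Y dY"
proof -
  obtain R where R: "Domain R = X" "Range R = Y" "controlled dX dY R" "controlled dY dX (R\<inverse>)"
    using assms(3) by (auto simp: corresponding_def coarse_correspondence_def)
  have "\<forall>x\<in>X. \<exists>y. (x, y) \<in> R" "\<forall>y\<in>Y. \<exists>x. (x, y) \<in> R" using R(1,2) by blast+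
  then obtain f g where f: "\<And>x. x \<in> X \<Longrightarrow> (x, f x) \<in> R" and g: "\<And>y. y \<in> Y \<Longrightarrow> (g y, y) \<in> R"
    by metis
  have fY: "f x \<in> Y" if "x \<in> X" for x using f[OF that] R(2) by blast
  have gX: "g y \<in> X" if "y \<in> Y" for y using g[OF that] R(1) by blast
  have "coarse_map X dX Y dY f"
    unfolding coarse_map_iff
  proof (intro conjI allI impI)
    fix \<delta> :: real
    obtain \<eta> where "\<And>x y x' y'. \<lbrakk>(x, y) \<in> R; (x', y') \<in> R; dX x x' \<le> \<delta>\<rbrakk> \<Longrightarrow> dY y y' \<le> \<eta>"
      using controlledE[OF R(3)] by metis
    then show "\<exists>K. \<forall>x\<in>X. \<forall>x'\<in>X. dX x x' \<le> \<delta> \<longrightarrow> dY (f x) (f x') \<le> K"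
      using f by blast
  qed (use fY in blast)
  moreover have "coarse_map Y dY X dX g"
    unfolding coarse_map_iff
  proof (intro conjI allI impI)
    fix \<delta> :: real
    obtain \<eta> where "\<And>x y x' y'. \<lbrakk>(x, y) \<in> R\<inverse>; (x', y') \<in> R\<inverse>; dY x x' \<le> \<delta>\<rbrakk> \<Longrightarrow> dX y y' \<le> \<eta>"
      using controlledE[OF R(4)] by metis
    then show "\<exists>K. \<forall>x\<in>Y. \<forall>x'\<in>Y. dY x x' \<le> \<delta> \<longrightarrow> dX (g x) (g x') \<le> K"
      using g by blast
  qed (use gX in blast)
  moreover have "\<exists>K. \<forall>x\<in>X. dX x (g (f x)) \<le> K"
  proof -
    obtain \<eta> where "\<And>x y x' y'. \<lbrakk>(x, y) \<in> R\<inverse>; (x', y') \<in> R\<inverse>; dY x x' \<le> 0\<rbrakk> \<Longrightarrow> dX y y' \<le> \<eta>"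
      using controlledE[OF R(4)] by metis
    then show ?thesis using f g fY Metric_space.mdist_zero[OF Y] by (metis converse.intros order_refl)
  qed
  moreover have "\<exists>K. \<forall>y\<in>Y. dY y (f (g y)) \<le> K"
  proof -
    obtain \<eta> where "\<And>x y x' y'. \<lbrakk>(x, y) \<in> R; (x', y') \<in> R; dX x x' \<le> 0\<rbrakk> \<Longrightarrow> dY y y' \<le> \<eta>"
      using controlledE[OF R(3)] by metis
    then show ?thesis using f g gX Metric_space.mdist_zero[OF X] by (metis order_refl)
  qed
  ultimately show ?thesis
    unfolding coarsely_equivalent_def coarse_equivalence_def SUP_ereal_less_PInf_iff by blast
qed

text \<open>
  The graph of \<open>f\<close> need not project onto \<open>Y\<close>.  Thickening it by the distance between the
  identity of \<open>Y\<close> and \<open>f \<circ> g\<close> repairs this, because then \<open>(g y, y)\<close> lies in it.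
\<close>

lemma corresponding_if_coarsely_equivalent:
  assumes X: "Metric_space X dX" and Y: "Metric_space Y dY"
    and "coarsely_equivalent X dX Y dY"
  shows "corresponding X dX Y dY"
proof -
  obtain f g K L where f: "coarse_map X dX Y dY f" and g: "coarse_map Y dY X dX g"
    and K: "\<And>x. x \<in> X \<Longrightarrow> dX x (g (f x)) \<le> K" and L: "\<And>y. y \<in> Y \<Longrightarrow> dY y (f (g y)) \<le> L"
    using assms(3)
    unfolding coarsely_equivalent_def coarse_equivalence_def SUP_ereal_less_PInf_iff by blast
  interpret X: Metric_space X dX by (rule X)
  interpret Y: Metric_space Y dY by (rule Y)
  have fY: "f x \<in> Y" if "x \<in> X" for x using f that by (auto simp: coarse_map_iff)
  have gX: "g y \<in> X" if "y \<in> Y" for y using g that by (auto simp: coarse_map_iff)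
  define R where "R = {(x, y). x \<in> X \<and> y \<in> Y \<and> dY y (f x) \<le> max L 0}"
  have "Domain R = X"
  proof -
    have "(x, f x) \<in> R" if "x \<in> X" for x using that fY by (simp add: R_def)
    then show ?thesis by (auto simp: R_def)
  qed
  moreover have "Range R = Y"
  proof -
    have "(g y, y) \<in> R" if "y \<in> Y" for y using that gX L by (simp add: R_def le_max_iff_disj)
    then show ?thesis by (auto simp: R_def)
  qed
  moreover have "controlled dX dY R"
  proof (rule controlledI)
    fix \<delta>
    obtain M where M: "\<And>x x'. \<lbrakk>x \<in> X; x' \<in> X; dX x x' \<le> max \<delta> 0\<rbrakk> \<Longrightarrow> dY (f x) (f x') \<le> M"
      using f unfolding coarse_map_iff by (meson max.cobounded2)
    have "dY y y' \<le> M + 2 * max L 0" if "(x, y) \<in> R" "(x', y') \<in> R" "dX x x' \<le> \<delta>" for x y x' y'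
    proof -
      have xy: "x \<in> X" "y \<in> Y" "dY y (f x) \<le> max L 0" "x' \<in> X" "y' \<in> Y" "dY y' (f x') \<le> max L 0"
        using that by (auto simp: R_def)
      have "dY y y' \<le> dY y (f x) + dY (f x) y'" using Y.triangle xy fY by blast
      also have "dY (f x) y' \<le> dY (f x) (f x') + dY (f x') y'" using Y.triangle xy fY by blast
      also have "dY (f x) (f x') \<le> M" by (rule M) (use xy that in auto)
      finally show ?thesis using xy by (simp add: Y.commute)
    qed
    then show "\<exists>\<eta>. \<forall>x y x' y'. (x, y) \<in> R \<longrightarrow> (x', y') \<in> R \<longrightarrow> dX x x' \<le> \<delta> \<longrightarrow> dY y y' \<le> \<eta>"
      by blast
  qed
  moreover have "controlled dY dX (R\<inverse>)"
  proof (rule controlledI)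
    fix \<delta>
    obtain M where M: "\<And>x x'. \<lbrakk>x \<in> Y; x' \<in> Y; dY x x' \<le> max (\<delta> + 2 * max L 0) 0\<rbrakk> \<Longrightarrow> dX (g x) (g x') \<le> M"
      using g unfolding coarse_map_iff by (meson max.cobounded2)
    have "dX x x' \<le> M + 2 * K" if "(x, y) \<in> R" "(x', y') \<in> R" "dY y y' \<le> \<delta>" for x y x' y'
    proof -
      have xy: "x \<in> X" "y \<in> Y" "dY y (f x) \<le> max L 0" "x' \<in> X" "y' \<in> Y" "dY y' (f x') \<le> max L 0"
        using that by (auto simp: R_def)
      have "dY (f x) (f x') \<le> dY (f x) y + dY y (f x')" using Y.triangle xy fY by blast
      also have "dY y (f x') \<le> dY y y' + dY y' (f x')" using Y.triangle xy fY by blast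
      finally have "dY (f x) (f x') \<le> \<delta> + 2 * max L 0" using xy that by (simp add: Y.commute)
      then have 1: "dX (g (f x)) (g (f x')) \<le> M" by (intro M) (use xy fY in auto)
      have "dX x x' \<le> dX x (g (f x)) + dX (g (f x)) x'" using X.triangle xy fY gX by blast
      also have "dX (g (f x)) x' \<le> dX (g (f x)) (g (f x')) + dX (g (f x')) x'"
        using X.triangle xy fY gX by blast
      finally show ?thesis using 1 K[OF xy(1)] K[OF xy(4)] by (simp add: X.commute)
    qed
    then show "\<exists>\<eta>. \<forall>x y x' y'. (x, y) \<in> R\<inverse> \<longrightarrow> (x', y') \<in> R\<inverse> \<longrightarrow> dY x x' \<le> \<delta> \<longrightarrow> dX y y' \<le> \<eta>"
      by blast
  qed
  ultimately show ?thesis unfolding corresponding_def coarse_correspondence_def by blast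
qed

section \<open>Components as classes of a chain relation\<close>

definition near :: "'a set \<Rightarrow> ('a \<Rightarrow> 'a \<Rightarrow> real) \<Rightarrow> real \<Rightarrow> ('a \<times> 'a) set" where
  "near X d \<epsilon> = {(x, y). x \<in> X \<and> y \<in> X \<and> d x y \<le> \<epsilon>}"

text \<open>
  The \<open>\<epsilon>\<close>-components are the classes of this equivalence relation, which turns statements about
  components into statements about reflexive transitive closures.
\<close>

abbreviation link :: "'a set \<Rightarrow> ('a \<Rightarrow> 'a \<Rightarrow> real) \<Rightarrow> real \<Rightarrow> ('a \<times> 'a) set" where
  "link X d \<epsilon> \<equiv> (near X d \<epsilon>)\<^sup>*"

lemma eps_connected_iff:
  "eps_connected d \<epsilon> C \<longleftrightarrow> (\<forall>x\<in>C. \<forall>y\<in>C. (x, y) \<in> link C d \<epsilon>)"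
proof -
  have "(\<exists>n (z::nat \<Rightarrow> 'a). z 0 = x \<and> z n = y \<and> (\<forall>i\<le>n. z i \<in> C) \<and> (\<forall>i\<in>{1..n}. d (z (i - 1)) (z i) \<le> \<epsilon>))
      \<longleftrightarrow> (x, y) \<in> link C d \<epsilon>" (is "?L \<longleftrightarrow> ?R") if "x \<in> C" "y \<in> C" for x y
  proof
    assume ?L
    then obtain n and z :: "nat \<Rightarrow> 'a" where z: "z 0 = x" "z n = y" "\<forall>i\<le>n. z i \<in> C"
      "\<forall>i\<in>{1..n}. d (z (i - 1)) (z i) \<le> \<epsilon>" by blast
    have "(z i, z (Suc i)) \<in> near C d \<epsilon>" if "i < n" for i
      using z(3) bspec[OF z(4), of "Suc i"] that by (auto simp: near_def)
    then show ?R using z(1,2) by (auto simp: rtrancl_power relpow_fun_conv)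
  next
    assume ?R
    then obtain n and z :: "nat \<Rightarrow> 'a" where z: "z 0 = x" "z n = y"
      "\<forall>i<n. (z i, z (Suc i)) \<in> near C d \<epsilon>"
      by (auto simp: rtrancl_power relpow_fun_conv)
    have "z i \<in> C" if "i \<le> n" for i
      using z that \<open>y \<in> C\<close> by (cases "i = n") (auto simp: near_def)
    moreover have "d (z (i - 1)) (z i) \<le> \<epsilon>" if "i \<in> {1..n}" for i
      using spec[OF z(3), of "i - 1"] that by (auto simp: near_def)
    ultimately show ?L using z(1,2) by blast
  qed
  then show ?thesis unfolding eps_connected_def by blast
qed

lemma link_mono: "\<delta> \<le> \<epsilon> \<Longrightarrow> link X d \<delta> \<subseteq> link X d \<epsilon>"
  by (rule rtrancl_mono) (auto simp: near_def)

lemma link_in: "(x, y) \<in> link X d \<epsilon> \<Longrightarrow> x \<in> X \<Longrightarrow> y \<in> X"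
  by (induction rule: rtrancl_induct) (auto simp: near_def)

lemma link_class_subset: "x \<in> X \<Longrightarrow> link X d \<epsilon> `` {x} \<subseteq> X"
  using link_in by auto

lemma near_link: "x \<in> X \<Longrightarrow> y \<in> X \<Longrightarrow> d x y \<le> \<epsilon> \<Longrightarrow> (x, y) \<in> link X d \<epsilon>"
  by (rule r_into_rtrancl) (simp add: near_def)

lemma large_scale_connected_iff:
  "large_scale_connected d X \<longleftrightarrow> (\<exists>\<epsilon>\<ge>0. \<forall>x\<in>X. \<forall>y\<in>X. (x, y) \<in> link X d \<epsilon>)"
  by (simp add: large_scale_connected_def eps_connected_iff)

text \<open>
  Membership in the set whose infimum is the factorizing step.
\<close>

definition factorizes :: "'a set \<Rightarrow> ('a \<Rightarrow> 'a \<Rightarrow> real) \<Rightarrow> real \<Rightarrow> bool" where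
  "factorizes X d \<epsilon> \<longleftrightarrow> 0 \<le> \<epsilon> \<and>
     (\<forall>\<delta>\<ge>\<epsilon>. \<forall>x\<in>X. finite ((\<lambda>y. link X d \<epsilon> `` {y}) ` (link X d \<delta> `` {x})))"

definition self_isometry :: "'a set \<Rightarrow> ('a \<Rightarrow> 'a \<Rightarrow> real) \<Rightarrow> ('a \<Rightarrow> 'a) \<Rightarrow> bool" where
  "self_isometry X d f \<longleftrightarrow> bij_betw f X X \<and> (\<forall>a\<in>X. \<forall>b\<in>X. d (f a) (f b) = d a b)"

lemma self_isometry_id: "self_isometry X d id"
  by (simp add: self_isometry_def)

lemma self_isometry_comp:
  "self_isometry X d f \<Longrightarrow> self_isometry X d g \<Longrightarrow> self_isometry X d (f \<circ> g)"
  unfolding self_isometry_def by (auto simp: bij_betw_apply bij_betw_trans[of g X X f])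

lemma self_isometry_in: "self_isometry X d f \<Longrightarrow> x \<in> X \<Longrightarrow> f x \<in> X"
  by (auto simp: self_isometry_def bij_betw_apply)

lemma self_isometry_surj: "self_isometry X d f \<Longrightarrow> y \<in> X \<Longrightarrow> \<exists>x\<in>X. y = f x"
  unfolding self_isometry_def bij_betw_def by blast

lemma self_isometry_link_iff:
  assumes f: "self_isometry X d f" and "x \<in> X" "y \<in> X"
  shows "(f x, f y) \<in> link X d \<epsilon> \<longleftrightarrow> (x, y) \<in> link X d \<epsilon>"
proof
  have pres: "(g a, g b) \<in> link X d \<epsilon>" if "(a, b) \<in> link X d \<epsilon>" "self_isometry X d g" for g a b
    using that
  proof (induction rule: rtrancl_induct)
    case (step b c)
    then have "(g b, g c) \<in> near X d \<epsilon>" by (auto simp: near_def self_isometry_def bij_betw_apply)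
    then show ?case using step by (meson rtrancl.rtrancl_into_rtrancl)
  qed simp
  then show "(x, y) \<in> link X d \<epsilon> \<Longrightarrow> (f x, f y) \<in> link X d \<epsilon>" using f by blast
  let ?g = "the_inv_into X f"
  have bij: "bij_betw f X X" using f by (simp add: self_isometry_def)
  have fg: "f (?g a) = a" "?g a \<in> X" if "a \<in> X" for a
    using that bij by (auto simp: bij_betw_def f_the_inv_into_f intro: the_inv_into_into)
  have "d (?g a) (?g b) = d a b" if "a \<in> X" "b \<in> X" for a b
    using f fg that unfolding self_isometry_def by metis
  then have "self_isometry X d ?g" using bij_betw_the_inv_into[OF bij] by (simp add: self_isometry_def)
  moreover have "?g (f a) = a" if "a \<in> X" for a using that bij by (simp add: bij_betw_def the_inv_into_f_f)
  ultimately show "(x, y) \<in> link X d \<epsilon>" if "(f x, f y) \<in> link X d \<epsilon>"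
    using pres[OF that, of ?g] assms(2,3) by simp
qed

context Metric_space
begin

lemma link_sym: "(x, y) \<in> link M d \<epsilon> \<Longrightarrow> (y, x) \<in> link M d \<epsilon>"
proof -
  have "sym (near M d \<epsilon>)" by (auto simp: sym_def near_def commute)
  then show "(x, y) \<in> link M d \<epsilon> \<Longrightarrow> (y, x) \<in> link M d \<epsilon>" by (meson sym_rtrancl symD)
qed

lemma link_class_eq_iff: "link M d \<epsilon> `` {x} = link M d \<epsilon> `` {y} \<longleftrightarrow> (x, y) \<in> link M d \<epsilon>"
proof
  have sub: "link M d \<epsilon> `` {b} \<subseteq> link M d \<epsilon> `` {a}" if "(a, b) \<in> link M d \<epsilon>" for a b
    using rtrancl_trans[OF that] by auto
  assume xy: "(x, y) \<in> link M d \<epsilon>"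
  show "link M d \<epsilon> `` {x} = link M d \<epsilon> `` {y}"
    using sub[OF xy] sub[OF link_sym[OF xy]] by (rule equalityI[rotated])
next
  assume "link M d \<epsilon> `` {x} = link M d \<epsilon> `` {y}"
  moreover have "y \<in> link M d \<epsilon> `` {y}" by simp
  ultimately have "y \<in> link M d \<epsilon> `` {x}" by simp
  then show "(x, y) \<in> link M d \<epsilon>" by simp
qed

text \<open>
  A chain in the ambient space that starts at \<open>x\<close> never leaves the class of \<open>x\<close>, so this class is
  \<open>\<epsilon>\<close>-connected in itself and not only inside the ambient space.
\<close>

lemma eps_component_eq:
  assumes x: "x \<in> M"
  shows "eps_component M d (ereal \<epsilon>) x = link M d \<epsilon> `` {x}"
proof
  note K = eps_component_greatest[OF x, where d=d and \<epsilon>=\<epsilon>]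
  have "link (eps_component M d (ereal \<epsilon>) x) d \<epsilon> \<subseteq> link M d \<epsilon>"
    by (rule rtrancl_mono) (use K(1) in \<open>auto simp: near_def\<close>)
  then show "eps_component M d (ereal \<epsilon>) x \<subseteq> link M d \<epsilon> `` {x}"
    using K(2,3) unfolding eps_connected_iff by blast
next
  let ?S = "link M d \<epsilon> `` {x}"
  have to: "(x, y) \<in> link ?S d \<epsilon>" if "(x, y) \<in> link M d \<epsilon>" for y
    using that
  proof (induction rule: rtrancl_induct)
    case (step y z)
    then have "(y, z) \<in> near ?S d \<epsilon>" by (simp add: near_def) (auto intro: rtrancl_into_rtrancl simp: near_def)
    then show ?case using step by (meson rtrancl.rtrancl_into_rtrancl)
  qed simp
  have S: "?S \<subseteq> M" using link_class_subset[OF x] .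
  interpret S: Metric_space ?S d using subspace[OF S] .
  have "eps_connected d \<epsilon> ?S"
    unfolding eps_connected_iff using to S.link_sym by (meson Image_singleton_iff rtrancl_trans)
  then show "?S \<subseteq> eps_component M d (ereal \<epsilon>) x"
    by (intro eps_component_greatest(4)[OF x S]) auto
qed

lemma large_scale_connected_component:
  assumes "x \<in> M" "0 \<le> \<epsilon>"
  shows "large_scale_connected d (link M d \<epsilon> `` {x})"
  using assms eps_component_greatest(3)[OF assms(1), of d \<epsilon>]
  by (auto simp: large_scale_connected_def eps_component_eq)

lemma factorizing_step_eq: "factorizing_step M d = Inf ({\<infinity>} \<union> {ereal \<epsilon> | \<epsilon>. factorizes M d \<epsilon>})"
proof -
  have "{eps_component M d (ereal \<epsilon>) y | y. y \<in> eps_component M d (ereal \<delta>) x}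
      = (\<lambda>y. link M d \<epsilon> `` {y}) ` (link M d \<delta> `` {x})" if "x \<in> M" for \<epsilon> \<delta> x
  proof -
    have "eps_component M d (ereal \<epsilon>) y = link M d \<epsilon> `` {y}" if "y \<in> link M d \<delta> `` {x}" for y
      using that link_class_subset[OF \<open>x \<in> M\<close>] by (intro eps_component_eq) blast
    then show ?thesis unfolding eps_component_eq[OF that] Setcompr_eq_image by (rule image_cong[OF refl])
  qed
  then show ?thesis by (simp add: factorizing_step_def factorizes_def cong: conj_cong ball_cong)
qed

lemma large_scale_connected_factorizes:
  assumes "large_scale_connected d M"
  shows "\<exists>\<epsilon>. factorizes M d \<epsilon>"
proof -
  obtain \<epsilon> where \<epsilon>: "0 \<le> \<epsilon>" "\<forall>x\<in>M. \<forall>y\<in>M. (x, y) \<in> link M d \<epsilon>"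
    using assms by (auto simp: large_scale_connected_iff)
  have "(\<lambda>y. link M d \<epsilon> `` {y}) ` (link M d \<delta> `` {x}) \<subseteq> {M}" if "x \<in> M" for \<delta> x
  proof (intro subsetI, elim imageE)
    fix C y assume C: "C = link M d \<epsilon> `` {y}" "y \<in> link M d \<delta> `` {x}"
    then have "y \<in> M" using link_in[OF _ that] by blast
    then have "C = M" using C(1) \<epsilon>(2) link_class_subset[of y M] by blast
    then show "C \<in> {M}" by simp
  qed
  then have "finite ((\<lambda>y. link M d \<epsilon> `` {y}) ` (link M d \<delta> `` {x}))" if "x \<in> M" for \<delta> x
    using that by (meson finite.emptyI finite.insertI finite_subset)
  then have "factorizes M d \<epsilon>" using \<epsilon>(1) by (simp add: factorizes_def)
  then show ?thesis ..
qed

lemma corresponding_dense: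
  assumes "A \<subseteq> B" "B \<subseteq> M" "\<And>b. b \<in> B \<Longrightarrow> \<exists>a\<in>A. d b a \<le> K"
  shows "corresponding A d B d"
proof -
  define R where "R = {(a, b). a \<in> A \<and> b \<in> B \<and> d b a \<le> max K 0}"
  have "(a, a) \<in> R" if "a \<in> A" for a using that assms by (auto simp: R_def)
  then have "Domain R = A" by (auto simp: R_def)
  moreover have "Range R = B" 
  proof
    show "B \<subseteq> Range R"
    proof
      fix b assume "b \<in> B"
      then obtain a where "a \<in> A" "d b a \<le> K" using assms(3) by blast
      then have "(a, b) \<in> R" using \<open>b \<in> B\<close> by (simp add: R_def le_max_iff_disj)
      then show "b \<in> Range R" by blast
    qed
  qed (auto simp: R_def)
  moreover have quad: "d b b' \<le> d a a' + 2 * max K 0" "d a a' \<le> d b b' + 2 * max K 0"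
    if "(a, b) \<in> R" "(a', b') \<in> R" for a b a' b'
  proof -
    have m: "a \<in> M" "a' \<in> M" "b \<in> M" "b' \<in> M" using that assms by (auto simp: R_def)
    have "d b b' \<le> d b a + (d a a' + d a' b')" "d a a' \<le> d a b + (d b b' + d b' a')"
      using m triangle[of b a b'] triangle[of a a' b'] triangle[of a b a'] triangle[of b b' a'] by linarith+
    then show "d b b' \<le> d a a' + 2 * max K 0" "d a a' \<le> d b b' + 2 * max K 0"
      using that commute[of a b] commute[of a' b'] by (auto simp: R_def)
  qed
  have "controlled d d R"
  proof (rule controlledI)
    show "\<exists>\<eta>. \<forall>x y x' y'. (x, y) \<in> R \<longrightarrow> (x', y') \<in> R \<longrightarrow> d x x' \<le> \<delta> \<longrightarrow> d y y' \<le> \<eta>" for \<delta>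
      by (rule exI[of _ "\<delta> + 2 * max K 0"]) (use quad(1) in force)
  qed
  moreover have "controlled d d (R\<inverse>)"
  proof (rule controlledI)
    show "\<exists>\<eta>. \<forall>x y x' y'. (x, y) \<in> R\<inverse> \<longrightarrow> (x', y') \<in> R\<inverse> \<longrightarrow> d x x' \<le> \<delta> \<longrightarrow> d y y' \<le> \<eta>" for \<delta>
      by (rule exI[of _ "\<delta> + 2 * max K 0"]) (use quad(2) in force)
  qed
  ultimately show ?thesis unfolding corresponding_def coarse_correspondence_def by blast
qed

end

section \<open>Components of a shift-homogeneous space\<close>

locale shift_space = Metric_space M d for M :: "'a set" and d +
  assumes shift: "shift_homogeneous M d"
begin

lemma shift_isometry:
  assumes "x \<in> M" "y \<in> M"
  shows "\<exists>f. self_isometry M d f \<and> f x = y \<and>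
    (\<forall>\<epsilon>\<ge>0. \<forall>z\<in>M. \<exists>K. \<forall>c\<in>link M d \<epsilon> `` {z}. d (f c) c \<le> K)"
proof -
  obtain f where f: "bij_betw f M M" "\<forall>a\<in>M. \<forall>b\<in>M. d (f a) (f b) = d a b" "f x = y"
    "\<forall>C\<subseteq>M. large_scale_connected d C \<longrightarrow> (SUP c\<in>C. ereal (d (f c) c)) < \<infinity>"
    using bspec[OF bspec[OF shift[unfolded shift_homogeneous_def] assms(1)] assms(2)] by blast
  show ?thesis
  proof (rule exI[of _ f], intro conjI allI impI ballI)
    show "self_isometry M d f" using f by (simp add: self_isometry_def)
    fix \<epsilon> :: real and z assume "0 \<le> \<epsilon>" "z \<in> M"
    moreover have "link M d \<epsilon> `` {z} \<subseteq> M" using link_class_subset[OF \<open>z \<in> M\<close>] .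
    ultimately show "\<exists>K. \<forall>c\<in>link M d \<epsilon> `` {z}. d (f c) c \<le> K"
      using f(4) large_scale_connected_component unfolding SUP_ereal_less_PInf_iff by blast
  qed (rule f)
qed

text \<open>
  Coordinates for one level: the \<open>\<delta>\<close>-components inside a \<open>\<delta>'\<close>-component are finitely many, and each
  is reached from the one of \<open>x\<close> by exactly one of the isometries \<open>h t\<close>, all of which move the
  \<open>\<delta>'\<close>-component of \<open>x\<close> by a common bounded amount.  Finiteness is given for \<open>e\<close>-components and
  passes to \<open>\<delta> \<ge> e\<close> because the \<open>e\<close>-component of a point determines its \<open>\<delta>\<close>-component.  The
  normalization \<open>h 0 = id\<close> makes leading zero digits harmless.
\<close>

lemma shift_transversal:
  assumes e: "factorizes M d e" "e \<le> \<delta>" "\<delta> \<le> \<delta>'" and x: "x \<in> M"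
  shows "\<exists>(m::nat) h K. 0 < m \<and> h 0 = id \<and>
    (\<forall>t<m. self_isometry M d (h t) \<and> (x, h t x) \<in> link M d \<delta>' \<and>
      (\<forall>c\<in>link M d \<delta>' `` {x}. d (h t c) c \<le> K) \<and>
      (\<forall>s<m. (h s x, h t x) \<in> link M d \<delta> \<longrightarrow> s = t)) \<and>
    (\<forall>y\<in>link M d \<delta>' `` {x}. \<exists>t<m. (h t x, y) \<in> link M d \<delta>)"
proof -
  let ?cls = "\<lambda>y. link M d \<delta> `` {y}"
  define Q where "Q = ?cls ` (link M d \<delta>' `` {x})"
  have "finite ((\<lambda>y. link M d e `` {y}) ` (link M d \<delta>' `` {x}))"
    using e x by (auto simp: factorizes_def)
  moreover have "Q \<subseteq> (\<lambda>S. \<Union>(?cls ` S)) ` ((\<lambda>y. link M d e `` {y}) ` (link M d \<delta>' `` {x}))"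
  proof -
    have "?cls z = ?cls y" if "(y, z) \<in> link M d e" for y z
      using that link_mono[OF e(2), of M d] link_class_eq_iff by blast
    then have "?cls ` (link M d e `` {y}) = {?cls y}" for y by auto
    then have "?cls y = \<Union>(?cls ` (link M d e `` {y}))" for y by simp
    then show ?thesis unfolding Q_def by blast
  qed
  ultimately have "finite Q" by (meson finite_imageI finite_subset)
  then obtain xs where xs: "set xs = Q - {?cls x}" "distinct xs"
    using finite_distinct_list[of "Q - {?cls x}"] by auto
  \<comment> \<open>The component of \<open>x\<close> is listed first, so that index \<open>0\<close> can get the identity.\<close>
  define S where "S = ?cls x # xs"
  define m where "m = length S"
  have "?cls x \<in> Q" unfolding Q_def by blast
  then have S: "set S = Q" "distinct S" using xs by (auto simp: S_def)
  have reps: "\<exists>y. (x, y) \<in> link M d \<delta>' \<and> S ! t = ?cls y \<and> (t = 0 \<longrightarrow> y = x)" if "t < m" for t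
  proof (cases "t = 0")
    case False
    have "S ! t \<in> Q" using that S by (auto simp: m_def)
    then show ?thesis using False by (auto simp: Q_def)
  qed (auto simp: S_def)
  obtain r where r: "\<And>t. t < m \<Longrightarrow> (x, r t) \<in> link M d \<delta>'" "\<And>t. t < m \<Longrightarrow> S ! t = ?cls (r t)"
    "0 < m \<Longrightarrow> r 0 = x"
  proof -
    have "\<forall>t\<in>{..<m}. \<exists>y. (x, y) \<in> link M d \<delta>' \<and> S ! t = ?cls y \<and> (t = 0 \<longrightarrow> y = x)"
      using reps by blast
    from bchoice[OF this] show ?thesis using that by blast
  qed
  have m: "0 < m" by (simp add: m_def S_def)
  have \<delta>': "0 \<le> \<delta>'" using e by (simp add: factorizes_def)
  have "\<exists>f L. self_isometry M d f \<and> f x = r t \<and> (\<forall>c\<in>link M d \<delta>' `` {x}. d (f c) c \<le> L) \<and>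
      (t = 0 \<longrightarrow> f = id)" if "t < m" for t
  proof (cases "t = 0")
    case True
    have "d (id c) c \<le> 0" if "c \<in> link M d \<delta>' `` {x}" for c
    proof -
      have "c \<in> M" using that link_class_subset[OF x] by blast
      then show ?thesis by simp
    qed
    then show ?thesis using True r(3) m self_isometry_id by (intro exI[of _ id] exI[of _ 0]) auto
  next
    case False
    have "r t \<in> M" using link_in[OF r(1)[OF that] x] .
    then obtain f where f: "self_isometry M d f" "f x = r t"
      "\<forall>\<epsilon>\<ge>0. \<forall>z\<in>M. \<exists>K. \<forall>c\<in>link M d \<epsilon> `` {z}. d (f c) c \<le> K"
      using shift_isometry[OF x] by blast
    then obtain L where "\<forall>c\<in>link M d \<delta>' `` {x}. d (f c) c \<le> L" using \<delta>' x by blast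
    then show ?thesis using f(1,2) False by blast
  qed
  then have "\<forall>t\<in>{..<m}. \<exists>f L. self_isometry M d f \<and> f x = r t \<and>
      (\<forall>c\<in>link M d \<delta>' `` {x}. d (f c) c \<le> L) \<and> (t = 0 \<longrightarrow> f = id)" by blast
  from bchoice[OF this] obtain h where "\<forall>t\<in>{..<m}. \<exists>L. self_isometry M d (h t) \<and> h t x = r t \<and>
      (\<forall>c\<in>link M d \<delta>' `` {x}. d (h t c) c \<le> L) \<and> (t = 0 \<longrightarrow> h t = id)" ..
  from bchoice[OF this] obtain L where "\<forall>t\<in>{..<m}. self_isometry M d (h t) \<and> h t x = r t \<and>
      (\<forall>c\<in>link M d \<delta>' `` {x}. d (h t c) c \<le> L t) \<and> (t = 0 \<longrightarrow> h t = id)" ..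
  then have h: "\<And>t. t < m \<Longrightarrow> self_isometry M d (h t)" "\<And>t. t < m \<Longrightarrow> h t x = r t"
    "\<And>t c. t < m \<Longrightarrow> c \<in> link M d \<delta>' `` {x} \<Longrightarrow> d (h t c) c \<le> L t" "0 < m \<Longrightarrow> h 0 = id"
    by blast+
  show ?thesis
  \<comment> \<open>A sum of absolute values is a convenient common bound for the finitely many displacements.\<close>
  proof (rule exI[of _ m], rule exI[of _ h], rule exI[of _ "\<Sum>t<m. \<bar>L t\<bar>"], intro conjI allI impI ballI)
    show "d (h t c) c \<le> (\<Sum>t<m. \<bar>L t\<bar>)" if "t < m" "c \<in> link M d \<delta>' `` {x}" for t c
    proof -
      have "\<bar>L t\<bar> \<le> (\<Sum>t<m. \<bar>L t\<bar>)" using that by (intro member_le_sum) auto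
      then show ?thesis using h(3)[of t c] that by fastforce
    qed
    show "s = t" if "t < m" "s < m" "(h s x, h t x) \<in> link M d \<delta>" for s t
    proof -
      have "S ! s = S ! t" using that r(2) h(2) by (simp add: link_class_eq_iff)
      then show ?thesis using S(2) that by (simp add: m_def nth_eq_iff_index_eq)
    qed
    show "\<exists>t<m. (h t x, y) \<in> link M d \<delta>" if "y \<in> link M d \<delta>' `` {x}" for y
    proof -
      have "?cls y \<in> set S" using that S(1) by (auto simp: Q_def)
      then obtain t where "t < m" "S ! t = ?cls y" by (auto simp: in_set_conv_nth m_def)
      then show ?thesis using r(2) h(2) by (metis link_class_eq_iff)
    qed
  qed (use m h r in auto)
qed

text \<open>
  A point \<open>y\<close> of the larger component lies in \<open>h t\<close> applied to the component of \<open>x\<close>, for one of finitely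
  many isometries \<open>h t\<close>; the preimage of \<open>y\<close> is at bounded distance from \<open>y\<close>.
\<close>

lemma component_dense:
  assumes e: "factorizes M d e" "e \<le> \<delta>" and x: "x \<in> M"
  shows "\<exists>K. \<forall>y\<in>link M d \<delta> `` {x}. \<exists>c\<in>link M d e `` {x}. d y c \<le> K"
proof -
  obtain m :: nat and h K where
    t: "\<forall>t<m. self_isometry M d (h t) \<and> (x, h t x) \<in> link M d \<delta> \<and>
      (\<forall>c\<in>link M d \<delta> `` {x}. d (h t c) c \<le> K) \<and>
      (\<forall>s<m. (h s x, h t x) \<in> link M d e \<longrightarrow> s = t)"
    and cover: "\<forall>y\<in>link M d \<delta> `` {x}. \<exists>t<m. (h t x, y) \<in> link M d e"
    using shift_transversal[OF e(1) order_refl e(2) x] by (elim exE conjE)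
  note mp = t[THEN spec, THEN mp]
  note h = mp[THEN conjunct1] and K = mp[THEN conjunct2, THEN conjunct2, THEN conjunct1]
  show ?thesis
  proof (intro exI ballI)
    fix y assume y: "y \<in> link M d \<delta> `` {x}"
    then obtain t where t: "t < m" "(h t x, y) \<in> link M d e" using cover by blast
    have "y \<in> M" using y link_class_subset[OF x] by blast
    then obtain c where c: "c \<in> M" "y = h t c"
      using self_isometry_surj[OF h[OF t(1)]] by blast
    then have "(x, c) \<in> link M d e" using self_isometry_link_iff[OF h[OF t(1)] x c(1)] t(2) by simp
    moreover from this have "d y c \<le> K" using K[OF t(1)] link_mono[OF e(2), of M d] c(2) by blast
    ultimately show "\<exists>c\<in>link M d e `` {x}. d y c \<le> K" by blast
  qed
qed

text \<open>
  An isometry moves the base point, and coarse density compares the two scales.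
\<close>

lemma components_corresponding:
  assumes "factorizes M d e" "factorizes M d e'" "x \<in> M" "x' \<in> M"
  shows "corresponding (link M d e `` {x}) d (link M d e' `` {x'}) d"
proof -
  have grow: "corresponding (link M d e `` {x}) d (link M d e' `` {x}) d"
    if asm: "factorizes M d e" "e \<le> e'" "x \<in> M" for e e' x
  proof -
    obtain K where K: "\<forall>y\<in>link M d e' `` {x}. \<exists>c\<in>link M d e `` {x}. d y c \<le> K"
      using component_dense[OF asm] by blast
    have "link M d e `` {x} \<subseteq> link M d e' `` {x}" using link_mono[OF asm(2), of M d] by blast
    then show ?thesis using link_class_subset[OF asm(3)] K
      by (intro corresponding_dense[where K=K]) blast+
  qed
  obtain f where f: "self_isometry M d f" "f x = x'" using shift_isometry[OF assms(3,4)] by blast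
  define R where "R = {(a, f a) | a. a \<in> link M d e `` {x}}"
  have inM: "a \<in> M" if "a \<in> link M d e `` {x}" for a using that link_class_subset[OF assms(3)] by blast
  have "Domain R = link M d e `` {x}" by (auto simp: R_def)
  moreover have "Range R = link M d e `` {x'}"
  proof -
    have "f a \<in> link M d e `` {x'}" if "a \<in> link M d e `` {x}" for a
      using that self_isometry_link_iff[OF f(1) assms(3) inM[OF that]] f(2) by simp
    moreover have "b \<in> Range R" if "b \<in> link M d e `` {x'}" for b
    proof -
      have "b \<in> M" using that link_class_subset[OF assms(4)] by blast
      then obtain a where a: "a \<in> M" "b = f a" using self_isometry_surj[OF f(1)] by blast
      then show ?thesis using that self_isometry_link_iff[OF f(1) assms(3) a(1)] f(2) by (auto simp: R_def)
    qed
    ultimately show ?thesis by (auto simp: R_def)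
  qed
  moreover have iso: "d b b' = d a a'" if "(a, b) \<in> R" "(a', b') \<in> R" for a b a' b'
    using that f(1) inM by (auto simp: R_def self_isometry_def)
  have "controlled d d R"
  proof (rule controlledI)
    show "\<exists>\<eta>. \<forall>x y x' y'. (x, y) \<in> R \<longrightarrow> (x', y') \<in> R \<longrightarrow> d x x' \<le> \<delta> \<longrightarrow> d y y' \<le> \<eta>" for \<delta>
      by (rule exI[of _ \<delta>]) (simp add: iso)
  qed
  moreover have "controlled d d (R\<inverse>)"
  proof (rule controlledI)
    show "\<exists>\<eta>. \<forall>x y x' y'. (x, y) \<in> R\<inverse> \<longrightarrow> (x', y') \<in> R\<inverse> \<longrightarrow> d x x' \<le> \<delta> \<longrightarrow> d y y' \<le> \<eta>" for \<delta>
      by (rule exI[of _ \<delta>]) (auto dest: iso)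
  qed
  ultimately have move: "corresponding (link M d e `` {x}) d (link M d e `` {x'}) d"
    unfolding corresponding_def coarse_correspondence_def by blast
  show ?thesis
  proof (cases "e \<le> e'")
    case True
    then show ?thesis using corresponding_trans[OF move grow[OF assms(1) True assms(4)]] by simp
  next
    case False
    then have "corresponding (link M d e' `` {x'}) d (link M d e `` {x'}) d"
      using assms by (intro grow) auto
    then show ?thesis using corresponding_trans[OF move corresponding_sym] by blast
  qed
qed

text \<open>
  The factorizing step \<open>s\<close> is an infimum that has to be attained in effect.  By homogeneity all distances up to
  \<open>s + 1\<close> already occur from a single point, where they are finitely many.  So there is a gap of
  distances just above \<open>s\<close>, and a factorizing \<open>e\<close> in this gap has the same components as \<open>s\<close>.
\<close>

lemma factorizing_component_cases:
  assumes bf: "boundedly_finite M d" and C: "factorizing_component M d C"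
  obtains (infinite) "\<And>e. \<not> factorizes M d e" "C = M"
  | (finite) e x where "factorizes M d e" "x \<in> M" "C = link M d e `` {x}"
proof -
  obtain x where x: "x \<in> M" "C = eps_component M d (factorizing_step M d) x"
    using C by (auto simp: factorizing_component_def)
  show ?thesis
  proof (cases "\<exists>e. factorizes M d e")
    case False
    then have "factorizing_step M d = \<infinity>" by (simp add: factorizing_step_eq)
    then show ?thesis using False x infinite by (simp add: eps_component_def)
  next
    case True
    then obtain e0 where e0: "factorizes M d e0" ..
    then have "factorizing_step M d \<le> ereal e0"
      unfolding factorizing_step_eq by (intro Inf_lower) auto
    moreover have "0 \<le> factorizing_step M d"
      unfolding factorizing_step_eq by (intro Inf_greatest) (auto simp: factorizes_def)
    ultimately obtain s where s: "factorizing_step M d = ereal s"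
      by (cases "factorizing_step M d") auto
    define T where "T = d x ` mcball x (s + 1)"
    have T: "finite T" using bf mbounded_mcball unfolding T_def boundedly_finite_def by blast
    have dT: "d a b \<in> T" if ab: "a \<in> M" "b \<in> M" "d a b \<le> s + 1" for a b
    proof -
      obtain f where f: "self_isometry M d f" "f a = x" using shift_isometry[OF ab(1) x(1)] by blast
      then have "d x (f b) = d a b" using ab by (auto simp: self_isometry_def)
      moreover have "f b \<in> M" using f ab self_isometry_in by fast
      ultimately show ?thesis using ab x(1) unfolding T_def by (intro image_eqI[of _ _ "f b"]) auto
    qed
    \<comment> \<open>The least distance above \<open>s\<close>, capped at \<open>s + 1\<close>.\<close>
    define u where "u = Min (insert (s + 1) {t \<in> T. s < t})"
    have u: "s < u" "u \<le> s + 1" "\<And>t. t \<in> T \<Longrightarrow> s < t \<Longrightarrow> u \<le> t"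
      using T by (auto simp: u_def)
    have "Inf ({\<infinity>} \<union> {ereal \<epsilon> | \<epsilon>. factorizes M d \<epsilon>}) < ereal u"
      using s u(1) by (simp add: factorizing_step_eq)
    then obtain e where e: "factorizes M d e" "e < u" unfolding Inf_less_iff by auto
    have "factorizing_step M d \<le> ereal e"
      unfolding factorizing_step_eq using e by (intro Inf_lower) auto
    then have se: "s \<le> e" using s by simp
    have "d a b \<le> s" if "a \<in> M" "b \<in> M" "d a b \<le> e" for a b
      using dT[OF that(1,2)] u that e(2) by force
    then have "near M d s = near M d e" using se by (auto simp: near_def)
    then have "C = link M d e `` {x}" using x s by (simp add: eps_component_eq)
    then show ?thesis using finite e x by blast
  qed
qed

end

section \<open>Transfer along coarse correspondences\<close>

text \<open>
  Each step of an \<open>\<epsilon>\<close>-chain is translated separately, by choosing related points; the chain on the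
  other side may need the step size \<open>\<eta>\<close> of the control function.  Taking \<open>max \<epsilon> 0\<close> also allows for
  two points related to the same \<open>x\<close>.
\<close>

lemma controlled_link:
  assumes X: "Metric_space X dX" and R: "Domain R = X" "Range R = Y" "controlled dX dY R"
  shows "\<exists>\<epsilon>'\<ge>0. \<forall>x x' y y'. (x, y) \<in> R \<longrightarrow> (x', y') \<in> R \<longrightarrow>
    (x, x') \<in> link X dX \<epsilon> \<longrightarrow> (y, y') \<in> link Y dY \<epsilon>'"
proof -
  obtain \<eta> where \<eta>: "\<And>x y x' y'. \<lbrakk>(x, y) \<in> R; (x', y') \<in> R; dX x x' \<le> max \<epsilon> 0\<rbrakk> \<Longrightarrow> dY y y' \<le> \<eta>"
    using controlledE[OF R(3)] by metis
  have step: "(y, y') \<in> link Y dY (max \<eta> 0)"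
    if xy: "(x, y) \<in> R" "(x', y') \<in> R" "dX x x' \<le> max \<epsilon> 0" for x y x' y'
  proof (rule near_link)
    show "y \<in> Y" "y' \<in> Y" using R(2) xy by blast+
    show "dY y y' \<le> max \<eta> 0" using \<eta>[OF xy] by simp
  qed
  have "(y, y') \<in> link Y dY (max \<eta> 0)"
    if "(x, x') \<in> link X dX \<epsilon>" "(x, y) \<in> R" "(x', y') \<in> R" for x x' y y'
    using that
  proof (induction arbitrary: y' rule: rtrancl_induct)
    case base
    have "x \<in> X" using base R(1) by blast
    then have "dX x x \<le> max \<epsilon> 0" using Metric_space.mdist_zero[OF X, of x] by simp
    then show ?case using step base by blast
  next
    case (step z x')
    then have z: "z \<in> X" "dX z x' \<le> max \<epsilon> 0" by (auto simp: near_def)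
    then obtain w where w: "(z, w) \<in> R" using R(1) by blast
    have "(y, w) \<in> link Y dY (max \<eta> 0)" using step.IH step.prems(1) w by blast
    also have "(w, y') \<in> link Y dY (max \<eta> 0)"
      using \<open>\<And>y' y x' x. \<lbrakk>(x, y) \<in> R; (x', y') \<in> R; dX x x' \<le> max \<epsilon> 0\<rbrakk> \<Longrightarrow> (y, y') \<in> link Y dY (max \<eta> 0)\<close>
        w step.prems(2) z(2) by blast
    finally show ?case .
  qed
  then show ?thesis by (intro exI[of _ "max \<eta> 0"]) auto
qed

lemma large_scale_connected_transfer:
  assumes X: "Metric_space X dX" and c: "corresponding X dX Y dY" and "large_scale_connected dX X"
  shows "large_scale_connected dY Y"
proof -
  obtain R where R: "Domain R = X" "Range R = Y" "controlled dX dY R"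
    using c by (auto simp: corresponding_def coarse_correspondence_def)
  obtain \<epsilon> where \<epsilon>: "\<And>x y. x \<in> X \<Longrightarrow> y \<in> X \<Longrightarrow> (x, y) \<in> link X dX \<epsilon>"
    using assms(3) unfolding large_scale_connected_iff by blast
  obtain \<epsilon>' where \<epsilon>': "0 \<le> \<epsilon>'" "\<forall>x x' y y'. (x, y) \<in> R \<longrightarrow> (x', y') \<in> R \<longrightarrow>
      (x, x') \<in> link X dX \<epsilon> \<longrightarrow> (y, y') \<in> link Y dY \<epsilon>'"
    using controlled_link[OF X R, of \<epsilon>] by blast
  have "(y, y') \<in> link Y dY \<epsilon>'" if y: "y \<in> Y" "y' \<in> Y" for y y'
  proof -
    obtain x x' where xy: "(x, y) \<in> R" "(x', y') \<in> R" using y R(2) by blast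
    then have "x \<in> X" "x' \<in> X" using R(1) by blast+
    then show ?thesis using \<epsilon>'(2) \<epsilon> xy by blast
  qed
  then show ?thesis using \<epsilon>'(1) unfolding large_scale_connected_iff by blast
qed

text \<open>
  A \<open>\<delta>'\<close>-component of \<open>Y\<close> corresponds to a part of some \<open>\<delta>\<close>-component of \<open>X\<close>, which consists of
  finitely many \<open>e\<close>-components; each \<open>e\<close>-component of \<open>X\<close> that occurs determines a single
  \<open>e'\<close>-component of \<open>Y\<close>.
\<close>

lemma factorizes_transfer:
  assumes X: "Metric_space X dX" and Y: "Metric_space Y dY"
    and R: "coarse_correspondence X dX Y dY R" and e: "factorizes X dX e"
    and e': "0 \<le> e'" "\<forall>x x' y y'. (x, y) \<in> R \<longrightarrow> (x', y') \<in> R \<longrightarrow>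
      (x, x') \<in> link X dX e \<longrightarrow> (y, y') \<in> link Y dY e'"
  shows "factorizes Y dY e'"
  unfolding factorizes_def
proof (intro conjI allI impI ballI)
  have R': "Domain R = X" "Range R = Y" "controlled dY dX (R\<inverse>)"
    using R by (auto simp: coarse_correspondence_def)
  fix \<delta>' y assume \<delta>': "e' \<le> \<delta>'" and y: "y \<in> Y"
  obtain x where xy: "(x, y) \<in> R" using R' y by blast
  then have x: "x \<in> X" using R' by blast
  have "\<exists>\<epsilon>'\<ge>0. \<forall>x x' y y'. (x, y) \<in> R\<inverse> \<longrightarrow> (x', y') \<in> R\<inverse> \<longrightarrow>
    (x, x') \<in> link Y dY \<delta>' \<longrightarrow> (y, y') \<in> link X dX \<epsilon>'"
    by (rule controlled_link[OF Y _ _ R'(3)]) (use R' in auto)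
  then obtain \<delta>0 where \<delta>0: "\<And>x x' y y'. \<lbrakk>(x, y) \<in> R; (x', y') \<in> R; (y, y') \<in> link Y dY \<delta>'\<rbrakk>
      \<Longrightarrow> (x, x') \<in> link X dX \<delta>0" by blast
  define \<delta> where "\<delta> = max \<delta>0 e"
  let ?Q = "(\<lambda>x. link X dX e `` {x}) ` (link X dX \<delta> `` {x})"
  have fin: "finite ?Q" using e x by (simp add: factorizes_def \<delta>_def)
  \<comment> \<open>The \<open>e'\<close>-components are recovered from the \<open>e\<close>-components, hence are at most as many.\<close>
  have "(\<lambda>y. link Y dY e' `` {y}) ` (link Y dY \<delta>' `` {y}) \<subseteq> (\<lambda>S. link Y dY e' `` (R `` S)) ` ?Q"
  proof (rule image_subsetI)
    fix y' assume y': "y' \<in> link Y dY \<delta>' `` {y}"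
    then have "y' \<in> Y" using link_class_subset[OF y] by blast
    then obtain x' where xy': "(x', y') \<in> R" using R' by blast
    have "(x, x') \<in> link X dX \<delta>0" using \<delta>0[OF xy xy'] y' by simp
    then have x': "x' \<in> link X dX \<delta> `` {x}" using link_mono[of \<delta>0 \<delta> X dX] by (auto simp: \<delta>_def)
    have "link Y dY e' `` {y'} = link Y dY e' `` (R `` (link X dX e `` {x'}))"
    proof
      show "link Y dY e' `` {y'} \<subseteq> link Y dY e' `` (R `` (link X dX e `` {x'}))"
        using xy' by blast
      show "link Y dY e' `` (R `` (link X dX e `` {x'})) \<subseteq> link Y dY e' `` {y'}"
      proof
        fix w assume "w \<in> link Y dY e' `` (R `` (link X dX e `` {x'}))"
        then obtain a b where ab: "(x', a) \<in> link X dX e" "(a, b) \<in> R" "(b, w) \<in> link Y dY e'" by blast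
        have "(y', b) \<in> link Y dY e'" using e'(2) xy' ab by blast
        then show "w \<in> link Y dY e' `` {y'}" using ab(3) by (simp add: rtrancl_trans)
      qed
    qed
    then show "link Y dY e' `` {y'} \<in> (\<lambda>S. link Y dY e' `` (R `` S)) ` ?Q" using x' by blast
  qed
  then show "finite ((\<lambda>y. link Y dY e' `` {y}) ` (link Y dY \<delta>' `` {y}))"
    using fin by (meson finite_imageI finite_subset)
qed (rule e')

lemma corresponding_restrict:
  assumes R: "coarse_correspondence X dX Y dY R" and B: "B \<subseteq> Y"
  shows "corresponding (R\<inverse> `` B) dX B dY"
proof -
  let ?S = "R \<inter> UNIV \<times> B"
  have "Domain ?S = R\<inverse> `` B" by blast
  moreover have "Range ?S = B" using R B unfolding coarse_correspondence_def by blast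
  moreover have "controlled dX dY ?S" "controlled dY dX (?S\<inverse>)"
    using R unfolding coarse_correspondence_def controlled_def by (meson IntD1 converseD converseI)+
  ultimately show ?thesis unfolding corresponding_def coarse_correspondence_def by blast
qed

text \<open>
  The component \<open>B\<close> of \<open>y\<close> corresponds to the set \<open>R\<inverse> `` B\<close>, which contains the component \<open>A\<close> of \<open>x\<close> but
  may be larger.  It lies in a single \<open>\<delta>\<close>-component, in which \<open>A\<close> is coarsely dense.
\<close>

lemma (in shift_space) component_transfer:
  assumes Y: "Metric_space Y dY" and R: "coarse_correspondence M d Y dY R"
    and e: "factorizes M d e" and x: "x \<in> M"
  shows "\<exists>e' y. factorizes Y dY e' \<and> y \<in> Y \<and> corresponding (link M d e `` {x}) d (link Y dY e' `` {y}) dY"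
proof -
  have R': "Domain R = M" "Range R = Y" "controlled d dY R" "controlled dY d (R\<inverse>)"
    using R by (auto simp: coarse_correspondence_def)
  obtain y where xy: "(x, y) \<in> R" using R' x by blast
  then have y: "y \<in> Y" using R' by blast
  obtain e' where e': "0 \<le> e'" "\<forall>x x' y y'. (x, y) \<in> R \<longrightarrow> (x', y') \<in> R \<longrightarrow>
      (x, x') \<in> link M d e \<longrightarrow> (y, y') \<in> link Y dY e'"
    using controlled_link[OF Metric_space_axioms R'(1-3), of e] by blast
  have "\<exists>\<epsilon>'\<ge>0. \<forall>x x' y y'. (x, y) \<in> R\<inverse> \<longrightarrow> (x', y') \<in> R\<inverse> \<longrightarrow>
    (x, x') \<in> link Y dY e' \<longrightarrow> (y, y') \<in> link M d \<epsilon>'"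
    by (rule controlled_link[OF Y _ _ R'(4)]) (use R' in auto)
  then obtain \<delta>0 where \<delta>0: "\<And>x x' y y'. \<lbrakk>(x, y) \<in> R; (x', y') \<in> R; (y, y') \<in> link Y dY e'\<rbrakk>
      \<Longrightarrow> (x, x') \<in> link M d \<delta>0" by blast
  define \<delta> where "\<delta> = max \<delta>0 e"
  let ?A = "link M d e `` {x}" and ?B = "link Y dY e' `` {y}"
  obtain K where K: "\<forall>y\<in>link M d \<delta> `` {x}. \<exists>c\<in>?A. d y c \<le> K"
    using component_dense[OF e _ x, of \<delta>] by (auto simp: \<delta>_def)
  have sub: "R\<inverse> `` ?B \<subseteq> link M d \<delta> `` {x}"
  proof
    fix a assume "a \<in> R\<inverse> `` ?B"
    then obtain b where "(a, b) \<in> R" "(y, b) \<in> link Y dY e'" by blast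
    then have "(x, a) \<in> link M d \<delta>0" using \<delta>0[OF xy] by blast
    then show "a \<in> link M d \<delta> `` {x}" using link_mono[of \<delta>0 \<delta> M d] by (auto simp: \<delta>_def)
  qed
  have "corresponding ?A d (R\<inverse> `` ?B) d"
  proof (rule corresponding_dense)
    show "?A \<subseteq> R\<inverse> `` ?B"
    proof
      fix a assume a: "a \<in> ?A"
      then have "a \<in> M" using link_class_subset[OF x] by blast
      then obtain b where b: "(a, b) \<in> R" using R' by blast
      then have "(y, b) \<in> link Y dY e'" using e'(2) xy a by blast
      then show "a \<in> R\<inverse> `` ?B" using b by blast
    qed
    show "R\<inverse> `` ?B \<subseteq> M" using R' by blast
    show "\<And>b. b \<in> R\<inverse> `` ?B \<Longrightarrow> \<exists>a\<in>?A. d b a \<le> K" using K sub by blast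
  qed
  moreover have "corresponding (R\<inverse> `` ?B) d ?B dY"
    by (rule corresponding_restrict[OF R link_class_subset[OF y]])
  ultimately have "corresponding ?A d ?B dY" by (rule corresponding_trans)
  then show ?thesis using factorizes_transfer[OF Metric_space_axioms Y R e e'] y by blast
qed

lemma (in shift_space) component_corresponding_whole:
  assumes "large_scale_connected d M" and e: "factorizes M d e" and x: "x \<in> M"
  shows "corresponding (link M d e `` {x}) d M d"
proof -
  obtain \<epsilon> where "\<forall>x\<in>M. \<forall>y\<in>M. (x, y) \<in> link M d \<epsilon>"
    using assms(1) unfolding large_scale_connected_iff by blast
  then have all: "M \<subseteq> link M d (max \<epsilon> e) `` {x}" using x link_mono[of \<epsilon> "max \<epsilon> e" M d] by auto
  obtain K where "\<forall>y\<in>link M d (max \<epsilon> e) `` {x}. \<exists>c\<in>link M d e `` {x}. d y c \<le> K"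
    using component_dense[OF e _ x, of "max \<epsilon> e"] by auto
  then show ?thesis
    using all by (intro corresponding_dense[where K=K] link_class_subset x) auto
qed


section \<open>Block ultrametrics on the natural numbers\<close>

text \<open>
  The place values of a mixed radix number system: \<open>N i\<close> is the length of the blocks of level \<open>i\<close>.
\<close>

definition block_scale :: "(nat \<Rightarrow> nat) \<Rightarrow> bool" where
  "block_scale N \<longleftrightarrow> N 0 = 1 \<and> (\<forall>i. 0 < N i \<and> N i dvd N (Suc i)) \<and> (\<forall>b. \<exists>i. b \<le> N i)"

text \<open>
  The ultrametric whose value is the level of the smallest block containing both numbers.
\<close>

definition block_dist :: "(nat \<Rightarrow> nat) \<Rightarrow> nat \<Rightarrow> nat \<Rightarrow> real" where
  "block_dist N z z' = real (LEAST n. z div N n = z' div N n)"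

lemma block_scale_dvd:
  assumes "block_scale N" "i \<le> j"
  shows "N i dvd N j"
  using assms(2)
proof (induction j rule: dec_induct)
  case (step n)
  then show ?case using assms(1) dvd_trans unfolding block_scale_def by blast
qed simp

lemma div_eq_mono_dvd:
  fixes z z' k l :: nat
  assumes "k dvd l" "z div k = z' div k"
  shows "z div l = z' div l"
proof -
  obtain r where "l = k * r" using assms(1) by blast
  then show ?thesis using assms(2) by (simp add: div_mult2_eq)
qed

lemma block_dist_le_iff:
  assumes N: "block_scale N"
  shows "block_dist N z z' \<le> real n \<longleftrightarrow> z div N n = z' div N n"
proof
  obtain b where "Suc (max z z') \<le> N b" using N unfolding block_scale_def by blast
  then have "z div N b = z' div N b" by simp
  then have L: "z div N (LEAST n. z div N n = z' div N n) = z' div N (LEAST n. z div N n = z' div N n)"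
    by (rule LeastI)
  assume "block_dist N z z' \<le> real n"
  then have "(LEAST n. z div N n = z' div N n) \<le> n" by (simp add: block_dist_def)
  then show "z div N n = z' div N n" 
    using L block_scale_dvd[OF N] div_eq_mono_dvd by blast
next
  assume "z div N n = z' div N n"
  then show "block_dist N z z' \<le> real n" by (simp add: block_dist_def Least_le)
qed

text \<open>
  A stair lists the starting points of consecutive intervals whose lengths lie between \<open>a\<close> and
  \<open>A\<close>.  It encodes the monotone surjection that sends a number to the index of its interval.  The
  tower interleaving two block scales consists of such surjections, and the condition that two
  consecutive ones compose to division by \<open>n\<close> reads \<open>g (g' i) = n * i\<close> for their stairs.
\<close>

definition stair :: "(nat \<Rightarrow> nat) \<Rightarrow> nat \<Rightarrow> nat \<Rightarrow> bool" where
  "stair g a A \<longleftrightarrow> g 0 = 0 \<and> (\<forall>i. g i + a \<le> g (Suc i) \<and> g (Suc i) \<le> g i + A)"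

definition stair_index :: "(nat \<Rightarrow> nat) \<Rightarrow> nat \<Rightarrow> nat" where
  "stair_index g x = (GREATEST i. g i \<le> x)"

lemma stair_lower_bound: "stair g a A \<Longrightarrow> a * i \<le> g i"
proof (induction i)
  case (Suc i)
  then have "g i + a \<le> g (Suc i)" by (simp add: stair_def)
  then show ?case using Suc by simp
qed simp

lemma stair_strict_mono: "stair g a A \<Longrightarrow> 0 < a \<Longrightarrow> strict_mono g"
  unfolding strict_mono_Suc_iff
proof
  fix i
  assume "stair g a A" "0 < a"
  then have "g i + a \<le> g (Suc i)" by (simp add: stair_def)
  then show "g i < g (Suc i)" using \<open>0 < a\<close> by linarith
qed

text \<open>
  The interval index is the upper adjoint of the stair; this is how compositions of the
  surjections are computed from compositions of the stairs.
\<close>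

lemma le_stair_index_iff:
  assumes "stair g a A" "0 < a"
  shows "i \<le> stair_index g x \<longleftrightarrow> g i \<le> x"
proof -
  have sm: "strict_mono g" using stair_strict_mono assms by blast
  have bd: "\<forall>y. g y \<le> x \<longrightarrow> y \<le> x" using strict_mono_imp_increasing[OF sm] order_trans by blast
  have "g 0 \<le> x" using assms by (simp add: stair_def)
  then have "g (stair_index g x) \<le> x" unfolding stair_index_def by (rule GreatestI_nat[where P="\<lambda>i. g i \<le> x"]) (use bd in blast)
  moreover have "i \<le> stair_index g x" if "g i \<le> x"
    unfolding stair_index_def using Greatest_le_nat[where P="\<lambda>i. g i \<le> x", OF that] bd by blast
  ultimately show ?thesis using strict_mono_less_eq[OF sm, of i "stair_index g x"] by linarith
qed

lemma stair_index_eqI: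
  assumes "stair g a A" "0 < a" "g i \<le> x" "x < g (Suc i)"
  shows "stair_index g x = i"
  using le_stair_index_iff[OF assms(1,2), of i x] le_stair_index_iff[OF assms(1,2), of "Suc i" x] assms(3,4) by simp

lemma stair_index_bounds:
  assumes "stair g a A" "0 < a"
  shows "g (stair_index g x) \<le> x" "x < g (Suc (stair_index g x))"
  using le_stair_index_iff[OF assms, of "stair_index g x" x] le_stair_index_iff[OF assms, of "Suc (stair_index g x)" x] by auto

lemma stair_index_at:
  assumes "stair g a A" "0 < a"
  shows "stair_index g (g i) = i"
  using stair_strict_mono[OF assms] by (intro stair_index_eqI[OF assms]) (simp_all add: strict_mono_less)

text \<open>
  Given \<open>g\<close>, this stair takes the value \<open>n * i\<close> at \<open>g i\<close> and distributes the \<open>n\<close> units between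
  \<open>g i\<close> and \<open>g (i + 1)\<close> as evenly as integers permit, by rounding down a linear interpolation.
\<close>

definition refine_stair :: "nat \<Rightarrow> (nat \<Rightarrow> nat) \<Rightarrow> nat \<Rightarrow> nat" where
  "refine_stair n g x = n * stair_index g x + n * (x - g (stair_index g x)) div (g (Suc (stair_index g x)) - g (stair_index g x))"

lemma refine_stair_at:
  assumes "stair g a A" "0 < a"
  shows "refine_stair n g (g i) = n * i"
  by (simp add: refine_stair_def stair_index_at[OF assms])

text \<open>
  On an interval of length \<open>w\<close> the increments are \<open>n / w\<close> rounded down or up, and \<open>w\<close> lies between
  \<open>a\<close> and \<open>A\<close>.
\<close>

lemma stair_refine_stair:
  assumes g: "stair g a A" "0 < a" and "A * c \<le> n" "n \<le> a * C"
  shows "stair (refine_stair n g) c C"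
proof -
  have "refine_stair n g x + c \<le> refine_stair n g (Suc x) \<and> refine_stair n g (Suc x) \<le> refine_stair n g x + C" for x
  proof -
    define i where "i = stair_index g x"
    define w where "w = g (Suc i) - g i"
    define t where "t = x - g i"
    have b: "g i \<le> x" "x < g (Suc i)" using stair_index_bounds[OF g, of x] by (simp_all add: i_def)
    have w: "a \<le> w" "w \<le> A" "0 < w" 
    proof -
      have "g i + a \<le> g (Suc i)" "g (Suc i) \<le> g i + A" using g(1) by (simp_all add: stair_def)
      then show "a \<le> w" "w \<le> A" "0 < w" using g(2) by (simp_all add: w_def)
    qed
    have x: "refine_stair n g x = n * i + n * t div w"
      by (simp add: refine_stair_def i_def[symmetric] t_def w_def)
    have Sx: "refine_stair n g (Suc x) = n * i + (n * t + n) div w"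
    proof (cases "Suc x = g (Suc i)")
      case True
      then have "refine_stair n g (Suc x) = n * Suc i" using refine_stair_at[OF g] by metis
      moreover have "w = Suc t" using True b by (simp add: t_def w_def)
      ultimately show ?thesis by (simp add: add.commute flip: mult_Suc_right)
    next
      case False
      then have "stair_index g (Suc x) = i" using b by (intro stair_index_eqI[OF g]) auto
      moreover have "n * (Suc x - g i) = n * t + n" using b by (simp add: t_def Suc_diff_le)
      ultimately show ?thesis by (simp add: refine_stair_def w_def)
    qed
    have "c * w \<le> n" using w assms(3) by (metis mult.commute mult_le_mono1 order_trans)
    then have "(n * t + c * w) div w \<le> (n * t + n) div w" by (intro div_le_mono) simp
    moreover have "n \<le> C * w" using w assms(4) by (metis mult.commute mult_le_mono1 order_trans)
    then have "(n * t + n) div w \<le> (n * t + C * w) div w" by (intro div_le_mono) simp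
    ultimately show ?thesis using w by (simp add: x Sx)
  qed
  moreover have "refine_stair n g 0 = 0"
    using refine_stair_at[OF g, of n 0] g by (simp add: stair_def)
  ultimately show ?thesis by (simp add: stair_def)
qed

text \<open>
  The interpolation is local: its values below \<open>a * k\<close> depend only on the first \<open>k\<close> intervals of \<open>g\<close>.
  This contraction makes the backward recursion of the tower converge.
\<close>

lemma refine_stair_cong:
  assumes g: "stair g a A" "0 < a" and g': "stair g' a A" and eq: "\<And>i. i \<le> k \<Longrightarrow> g i = g' i"
    and x: "x < a * k"
  shows "refine_stair n g x = refine_stair n g' x"
proof -
  have "stair_index g x < k"
    using stair_lower_bound[OF g(1), of k] x le_stair_index_iff[OF g, of k x] by linarith
  then have eqs: "g (stair_index g x) = g' (stair_index g x)" "g (Suc (stair_index g x)) = g' (Suc (stair_index g x))" using eq by auto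
  then have "stair_index g' x = stair_index g x"
    using stair_index_bounds[OF g, of x] by (intro stair_index_eqI[OF g' g(2)]) auto
  then show ?thesis using eqs by (simp add: refine_stair_def)
qed

text \<open>
  In the tower the stair of level \<open>j\<close> is obtained from the stair of level \<open>j + 1\<close>, so the recursion runs
  down from infinity.  The approximation of depth \<open>d\<close> starts it at level \<open>j + d\<close> with the uniform
  stair of step \<open>q\<close>.
\<close>

fun approx_stair :: "(nat \<Rightarrow> nat) \<Rightarrow> (nat \<Rightarrow> nat) \<Rightarrow> nat \<Rightarrow> nat \<Rightarrow> nat \<Rightarrow> nat" where
  "approx_stair n q 0 j = (\<lambda>x. q j * x)"
| "approx_stair n q (Suc d) j = refine_stair (n j) (approx_stair n q d (Suc j))"

text \<open>
  Level \<open>j\<close> of the tower has intervals of lengths between \<open>a j\<close> and \<open>A j\<close>, the first of length \<open>q j\<close>, and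
  two consecutive levels compose to division by \<open>n j\<close>.  The assumptions \<open>quot\<close> make the even
  distribution at level \<open>j\<close> respect these bounds, and \<open>spine\<close> makes it reproduce the prescribed
  first interval.
\<close>

locale stair_tower =
  fixes a q A n :: "nat \<Rightarrow> nat"
  assumes bounds: "3 \<le> a j" "a j \<le> q j" "q j \<le> A j"
    and quot: "A (Suc j) * a j \<le> n j" "n j \<le> a (Suc j) * A j"
    and spine: "n j div q (Suc j) = q j"
begin

lemma apos: "0 < a j" using bounds(1)[of j] by simp

lemma stair_approx_stair: "stair (approx_stair n q d j) (a j) (A j)"
proof (induction d arbitrary: j)
  case 0
  then show ?case using bounds by (simp add: stair_def)
next
  case (Suc d)
  then show ?case using stair_refine_stair[OF Suc apos quot] by simp
qed

lemma approx_stair_1: "approx_stair n q d j 1 = q j"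
proof (induction d arbitrary: j)
  case (Suc d)
  let ?g = "approx_stair n q d (Suc j)"
  have g: "stair ?g (a (Suc j)) (A (Suc j))" by (rule stair_approx_stair)
  have "?g 0 = 0" using g by (simp add: stair_def)
  moreover have "1 < ?g 1" using bounds(1,2)[of "Suc j"] Suc by simp
  ultimately have "stair_index ?g 1 = 0" by (intro stair_index_eqI[OF g apos]) auto
  then show ?case using Suc \<open>?g 0 = 0\<close> spine by (simp add: refine_stair_def)
qed simp

text \<open>
  The first interval has length \<open>q j\<close> whatever the depth, and since all intervals have length at least
  \<open>3\<close>, agreement on an initial segment improves by one when passing one level down.
\<close>

lemma approx_stair_stable: "x \<le> Suc d \<Longrightarrow> approx_stair n q (Suc d) j x = approx_stair n q d j x"
proof (induction d arbitrary: j x)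
  case 0
  then consider "x = 0" | "x = 1" by linarith
  then show ?case
  proof cases
    case 1
    then show ?thesis using stair_approx_stair[of _ j] by (metis stair_def)
  qed (metis approx_stair_1)
next
  case (Suc d)
  have lt: "x < a (Suc j) * Suc d"
  proof -
    have "x < 3 * Suc d" using Suc.prems by simp
    also have "\<dots> \<le> a (Suc j) * Suc d" by (intro mult_le_mono1 bounds)
    finally show ?thesis .
  qed
  have "refine_stair (n j) (approx_stair n q (Suc d) (Suc j)) x = refine_stair (n j) (approx_stair n q d (Suc j)) x"
    by (rule refine_stair_cong[OF stair_approx_stair apos stair_approx_stair Suc.IH lt])
  then show ?case by (simp only: approx_stair.simps)
qed

definition limit_stair :: "nat \<Rightarrow> nat \<Rightarrow> nat" where
  "limit_stair j x = approx_stair n q x j x"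

lemma approx_stair_eq_limit: "x \<le> d \<Longrightarrow> approx_stair n q d j x = limit_stair j x"
proof (induction d rule: dec_induct)
  case (step m)
  then show ?case using approx_stair_stable[of x m j] by simp
qed (simp add: limit_stair_def)

lemma stair_limit_stair: "stair (limit_stair j) (a j) (A j)"
proof -
  have "limit_stair j i + a j \<le> limit_stair j (Suc i) \<and> limit_stair j (Suc i) \<le> limit_stair j i + A j" for i
  proof -
    have "approx_stair n q (Suc i) j i + a j \<le> approx_stair n q (Suc i) j (Suc i) \<and>
        approx_stair n q (Suc i) j (Suc i) \<le> approx_stair n q (Suc i) j i + A j"
      using stair_approx_stair[of "Suc i" j] unfolding stair_def by blast
    then show ?thesis by (simp only: approx_stair_eq_limit le_SucI order_refl)
  qed
  then show ?thesis by (simp add: stair_def limit_stair_def)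
qed

lemma limit_stair_limit_stair: "limit_stair j (limit_stair (Suc j) i) = n j * i"
proof -
  define d where "d = max i (limit_stair (Suc j) i)"
  have "limit_stair j (limit_stair (Suc j) i) = approx_stair n q (Suc d) j (approx_stair n q d (Suc j) i)"
    by (simp only: approx_stair_eq_limit d_def max.cobounded1 max.cobounded2 le_SucI)
  also have "\<dots> = n j * i" using refine_stair_at[OF stair_approx_stair apos] by simp
  finally show ?thesis .
qed

definition stair_map :: "nat \<Rightarrow> nat \<Rightarrow> nat" where
  "stair_map j = stair_index (limit_stair j)"

lemma surj_stair_map: "surj (stair_map j)"
  unfolding stair_map_def by (rule surjI[where f="limit_stair j"]) (rule stair_index_at[OF stair_limit_stair apos])

lemma npos: "0 < n j"
proof -
  have "0 < A (Suc j) * a j" using bounds[of "Suc j"] apos[of j] by simp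
  then show ?thesis using quot(1)[of j] by linarith
qed

text \<open>
  By adjunction, \<open>i\<close> is at most the left-hand side iff \<open>n j * i \<le> x\<close>.
\<close>

lemma stair_map_stair_map: "stair_map (Suc j) (stair_map j x) = x div n j"
proof -
  have "i \<le> stair_map (Suc j) (stair_map j x) \<longleftrightarrow> i \<le> x div n j" for i
    using le_stair_index_iff[OF stair_limit_stair apos] npos[of j]
    by (simp add: stair_map_def limit_stair_limit_stair less_eq_div_iff_mult_less_eq mult.commute)
  from this[of "stair_map (Suc j) (stair_map j x)"] this[of "x div n j"] show ?thesis by simp
qed

end

text \<open>
  Strict inequalities between the three lengths leave room for rounding: if \<open>n\<close> is large, the quotients of
  \<open>n\<close> by \<open>A\<close>, \<open>q\<close> and \<open>a\<close> are far apart, so that the next level can be chosen with strict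
  inequalities again.
\<close>

lemma stair_tower_step:
  fixes a q A n :: nat
  assumes "3 \<le> a" "a < q" "q < A" "2 * (q * A) \<le> n"
  shows "\<exists>a' q' A'. 3 \<le> a' \<and> a' < q' \<and> q' < A' \<and> A' * a \<le> n \<and> n \<le> a' * A \<and> n div q' = q"
proof (intro exI conjI)
  let ?k = "n div A" and ?l = "n div q"
  have k: "?k * A \<le> n" "2 * q \<le> ?k"
    using assms by (auto simp: less_eq_div_iff_mult_less_eq)
  have l: "?l * q \<le> n" "2 * A \<le> ?l"
    using assms by (auto simp: less_eq_div_iff_mult_less_eq mult.commute mult.left_commute)
  have "n mod q < q" "n mod A < A" using assms by auto
  then have up: "n < ?l * q + q" "n < ?k * A + A"
    using div_mult_mod_eq[of n q] div_mult_mod_eq[of n A] by linarith+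
  show "3 \<le> ?k + 1" using k assms by linarith
  show "?k + 1 < ?l"
  proof -
    have "(?k + 2) * q \<le> ?k * (q + 1)" using k by (simp add: algebra_simps)
    also have "\<dots> \<le> ?k * A" using assms by (intro mult_le_mono2) auto
    also have "\<dots> \<le> n" by (rule k)
    finally have "?k + 2 \<le> ?l" using assms by (simp add: less_eq_div_iff_mult_less_eq)
    then show ?thesis by simp
  qed
  show "?l < n div a"
  proof -
    have "(?l + 1) * a \<le> ?l * (a + 1)" using l assms by (simp add: algebra_simps)
    also have "\<dots> \<le> ?l * q" using assms by (intro mult_le_mono2) auto
    also have "\<dots> \<le> n" by (rule l)
    finally have "?l + 1 \<le> n div a" using assms by (simp add: less_eq_div_iff_mult_less_eq)
    then show ?thesis by simp
  qed
  show "n div a * a \<le> n" by simp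
  show "n \<le> (?k + 1) * A" using up by simp
  show "n div ?l = q" using l up assms by (intro div_nat_eqI) (auto simp: algebra_simps)
qed

text \<open>
  The even levels of the tower are blocks of \<open>N\<close> and the odd levels are blocks of \<open>N'\<close>; \<open>e j\<close> is the block
  level used at level \<open>j\<close>.  Levels are chosen one after the other, skipping block levels until
  the quotient \<open>n j\<close> is as large as the tower construction requires.
\<close>

lemma interleaved_scales:
  assumes N: "block_scale N" and N': "block_scale N'"
  shows "\<exists>e n p. (\<forall>i. i \<le> e (2 * i) \<and> i \<le> e (2 * i + 1)) \<and> e 0 = 0 \<and> e 1 = 0 \<and>
     (\<forall>i. N (e (2 * i + 2)) = N (e (2 * i)) * n (2 * i)) \<and>
     (\<forall>i. N' (e (2 * i + 3)) = N' (e (2 * i + 1)) * n (2 * i + 1)) \<and>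
     (\<forall>j. surj (p j :: nat \<Rightarrow> nat) \<and> (\<forall>x. p (Suc j) (p j x) = x div n j))"
proof -
  define P where "P j = (if even j then N else N')" for j :: nat
  have P: "block_scale (P j)" for j by (simp add: P_def N N')
  \<comment> \<open>A state holds the three lengths of level \<open>j\<close> and the block levels \<open>e j\<close> and \<open>e (j + 1)\<close>.\<close>
  define ok where "ok j s = (case s of (a, q, A, e, f) \<Rightarrow>
      3 \<le> a \<and> a < q \<and> q < A \<and> (j = 0 \<longrightarrow> e = 0 \<and> f = 0))" for j :: nat and s :: "nat \<times> nat \<times> nat \<times> nat \<times> nat"
  define nxt where "nxt j s s' = (case s of (a, q, A, e, f) \<Rightarrow> case s' of (a', q', A', e', f') \<Rightarrow>
      e' = f \<and> e < f' \<and> (\<exists>n. P j f' = P j e * n \<and> A' * a \<le> n \<and> n \<le> a' * A \<and> n div q' = q))"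
    for j and s s' :: "nat \<times> nat \<times> nat \<times> nat \<times> nat"
  have "\<exists>s. ok 0 s" by (rule exI[of _ "(3,4,5,0,0)"]) (simp add: ok_def)
  moreover have "\<exists>s'. ok (Suc j) s' \<and> nxt j s s'" if "ok j s" for j :: nat and s
  proof -
    obtain a q A e f where s: "s = (a, q, A, e, f)" by (cases s) auto
    have aqA: "3 \<le> a" "a < q" "q < A" using that by (auto simp: ok_def s)
    obtain f' where f': "Suc (P j e) * (2 * (q * A)) \<le> P j f'" using P[of j] unfolding block_scale_def by blast
    have Pe: "0 < P j e" using P[of j] unfolding block_scale_def by blast
    have big: "P j e < P j f'"
    proof -
      have "1 \<le> 2 * (q * A)" using aqA by (simp add: Suc_le_eq)
      then have "Suc (P j e) * 1 \<le> Suc (P j e) * (2 * (q * A))" by (intro mult_le_mono2)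
      from le_trans[OF this f'] show ?thesis by simp
    qed
    have ef: "e < f'"
    proof (rule ccontr)
      assume "\<not> e < f'"
      then have "P j f' dvd P j e" using block_scale_dvd[OF P] by simp
      then show False using big Pe by (meson dvd_imp_le not_less)
    qed
    then obtain n where n: "P j f' = P j e * n" using block_scale_dvd[OF P, of e f' j] by (auto elim: dvdE)
    have "2 * (q * A) \<le> n"
    proof -
      have "P j e * (2 * (q * A)) \<le> Suc (P j e) * (2 * (q * A))" by (intro mult_le_mono1) simp
      also have "\<dots> \<le> P j e * n" using f' n by simp
      finally show ?thesis using Pe by simp
    qed
    from stair_tower_step[OF aqA this] obtain a' q' A' where
      "3 \<le> a'" "a' < q'" "q' < A'" "A' * a \<le> n" "n \<le> a' * A" "n div q' = q" by blast
    then show ?thesis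
      using n ef by (intro exI[of _ "(a', q', A', f, f')"]) (auto simp: ok_def nxt_def s)
  qed
  ultimately obtain S where S: "\<And>j. ok j (S j)" "\<And>j. nxt j (S j) (S (Suc j))"
    using dependent_nat_choice[of ok nxt] by blast
  define a where "a j = fst (S j)" for j
  define q where "q j = fst (snd (S j))" for j
  define A where "A j = fst (snd (snd (S j)))" for j
  define e where "e j = fst (snd (snd (snd (S j))))" for j
  define f where "f j = snd (snd (snd (snd (S j))))" for j
  have Sj: "S j = (a j, q j, A j, e j, f j)" for j by (simp add: a_def q_def A_def e_def f_def)
  have 1: "3 \<le> a j" "a j < q j" "q j < A j" for j using S(1)[of j] by (auto simp: ok_def Sj)
  have 2: "e 0 = 0" "f 0 = 0" using S(1)[of 0] by (auto simp: ok_def Sj)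
  have fe: "e (Suc j) = f j" for j using S(2)[of j] by (auto simp: nxt_def Sj)
  have 3: "e j < e (Suc (Suc j))" for j using S(2)[of j] by (auto simp: nxt_def Sj fe)
  have "\<forall>j. \<exists>n. P j (e (Suc (Suc j))) = P j (e j) * n \<and> A (Suc j) * a j \<le> n \<and> n \<le> a (Suc j) * A j \<and> n div q (Suc j) = q j"
    using S(2) by (auto simp: nxt_def Sj fe)
  then obtain n where n: "\<And>j. P j (e (Suc (Suc j))) = P j (e j) * n j"
      "\<And>j. A (Suc j) * a j \<le> n j" "\<And>j. n j \<le> a (Suc j) * A j" "\<And>j. n j div q (Suc j) = q j"
    by metis
  interpret stair_tower a q A n
    by unfold_locales (use 1 n in \<open>simp_all add: less_imp_le\<close>)
  have "i \<le> e (2 * i) \<and> i \<le> e (2 * i + 1)" for i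
  proof (induction i)
    case (Suc i)
    then show ?case using 3[of "2 * i"] 3[of "2 * i + 1"] by simp
  qed simp
  moreover have "N (e (2 * i + 2)) = N (e (2 * i)) * n (2 * i)" for i
    using n(1)[of "2 * i"] by (simp add: P_def)
  moreover have "N' (e (2 * i + 3)) = N' (e (2 * i + 1)) * n (2 * i + 1)" for i
  proof -
    have "P (2 * i + 1) = N'" "Suc (Suc (2 * i + 1)) = 2 * i + 3" by (simp_all add: P_def)
    then show ?thesis using n(1)[of "2 * i + 1"] by metis
  qed
  ultimately show ?thesis using 2 fe[of 0] surj_stair_map stair_map_stair_map
    by (intro exI[of _ e] exI[of _ n] exI[of _ stair_map]) auto
qed

text \<open>
  The correspondence is the graph of the lowest map \<open>p 0\<close> of the tower.  Climbing from \<open>x\<close> computes its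
  blocks at even levels and the blocks of \<open>p 0 x\<close> at odd levels, so a coincidence of blocks on one
  side forces a coincidence one level higher on the other side.
\<close>

lemma block_scales_corresponding:
  assumes N: "block_scale N" and N': "block_scale N'"
  shows "corresponding UNIV (block_dist N) UNIV (block_dist N')"
proof -
  obtain e n p where e: "\<And>i. i \<le> e (2 * i)" "\<And>i. i \<le> e (2 * i + 1)" "e 0 = 0" "e 1 = 0"
    and Nn: "\<And>i. N (e (2 * i + 2)) = N (e (2 * i)) * n (2 * i)"
      "\<And>i. N' (e (2 * i + 3)) = N' (e (2 * i + 1)) * n (2 * i + 1)"
    and p: "\<And>j. surj (p j)" "\<And>j x. p (Suc j) (p j x) = x div n (j::nat)"
    using interleaved_scales[OF N N'] by blast
  define climb where "climb j x = rec_nat x p j" for j and x :: nat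
  have climb: "climb 0 x = x" "climb (Suc j) x = p j (climb j x)" for j x
    by (simp_all add: climb_def)
  have climb2: "climb (Suc (Suc j)) x = climb j x div n j" for j x by (simp add: climb p)
  have even: "climb (2 * i) x = x div N (e (2 * i))" for i x
  proof (induction i)
    case 0
    then show ?case using N e by (simp add: climb block_scale_def)
  next
    case (Suc i)
    have "climb (2 * Suc i) x = climb (2 * i) x div n (2 * i)" by (simp add: climb2)
    then show ?case using Suc Nn(1)[of i] by (simp add: div_mult2_eq)
  qed
  have odd: "climb (2 * i + 1) x = p 0 x div N' (e (2 * i + 1))" for i x
  proof (induction i)
    case 0
    then show ?case using N' e by (simp add: climb block_scale_def)
  next
    case (Suc i)
    have "climb (2 * Suc i + 1) x = climb (2 * i + 1) x div n (2 * i + 1)" by (simp add: climb2)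
    then show ?case using Suc Nn(2)[of i] by (simp add: div_mult2_eq eval_nat_numeral)
  qed
  define R where "R = {(x, p 0 x) | x. True}"
  have "Domain R = UNIV" by (auto simp: R_def)
  moreover have "Range R = UNIV"
  proof -
    have "y \<in> Range R" for y using surjD[OF p(1)[of 0], of y] by (auto simp: R_def)
    then show ?thesis by blast
  qed
  moreover have "controlled (block_dist N) (block_dist N') R"
  proof (rule controlledI)
    fix \<delta> :: real
    define k where "k = nat \<lceil>\<delta>\<rceil>"
    have "block_dist N' (p 0 x) (p 0 x') \<le> real (e (2 * k + 1))" if "block_dist N x x' \<le> \<delta>" for x x'
    proof -
      have "block_dist N x x' \<le> real (e (2 * k))" using that e(1)[of k] k_def by linarith
      then have "climb (2 * k) x = climb (2 * k) x'" by (simp add: even block_dist_le_iff[OF N])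
      then have "climb (2 * k + 1) x = climb (2 * k + 1) x'" by (simp add: climb)
      then show ?thesis unfolding odd by (simp add: block_dist_le_iff[OF N'])
    qed
    then show "\<exists>\<eta>. \<forall>x y x' y'. (x, y) \<in> R \<longrightarrow> (x', y') \<in> R \<longrightarrow> block_dist N x x' \<le> \<delta> \<longrightarrow> block_dist N' y y' \<le> \<eta>"
      by (auto simp: R_def)
  qed
  moreover have "controlled (block_dist N') (block_dist N) (R\<inverse>)"
  proof (rule controlledI)
    fix \<delta> :: real
    define k where "k = nat \<lceil>\<delta>\<rceil>"
    have "block_dist N x x' \<le> real (e (2 * (k + 1)))" if "block_dist N' (p 0 x) (p 0 x') \<le> \<delta>" for x x'
    proof -
      have "block_dist N' (p 0 x) (p 0 x') \<le> real (e (2 * k + 1))" using that e(2)[of k] k_def by linarith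
      then have "climb (2 * k + 1) x = climb (2 * k + 1) x'"
        unfolding odd by (simp add: block_dist_le_iff[OF N'])
      then have "climb (2 * (k + 1)) x = climb (2 * (k + 1)) x'" by (simp add: climb)
      then show ?thesis unfolding even by (simp add: block_dist_le_iff[OF N])
    qed
    then show "\<exists>\<eta>. \<forall>x y x' y'. (x, y) \<in> R\<inverse> \<longrightarrow> (x', y') \<in> R\<inverse> \<longrightarrow> block_dist N' x x' \<le> \<delta> \<longrightarrow> block_dist N y y' \<le> \<eta>"
      by (auto simp: R_def)
  qed
  ultimately show ?thesis unfolding corresponding_def coarse_correspondence_def by blast
qed

section \<open>Coordinates on a space that is not large scale connected\<close>

text \<open>
  A number \<open>z\<close> with digits \<open>t\<^sub>0, t\<^sub>1, \<dots>\<close> and a point \<open>c\<close> of the \<open>e\<close>-component of \<open>x\<close> name the point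
  \<open>\<dots> (h 1 t\<^sub>1 (h 0 t\<^sub>0 c))\<close>, a finite expression since \<open>h i 0\<close> is the identity.  Two points at
  distance at most \<open>e + n\<close> have the same digits from place \<open>n\<close> on.  Cancelling the common isometries
  leaves the first \<open>n\<close> of them, which move \<open>c\<close> by a bounded amount, so such points also have close
  first coordinates; the same cancellation gives the converse estimate.
\<close>

lemma (in shift_space) product_decomposition:
  assumes nlsc: "\<not> large_scale_connected d M" and e: "factorizes M d e" and x: "x \<in> M"
  shows "\<exists>N. block_scale N \<and>
    corresponding ((link M d e `` {x}) \<times> UNIV) (max_dist d (block_dist N)) M d"
proof -
  have e0: "0 \<le> e" using e by (simp add: factorizes_def)
  define ep where "ep i = e + real i" for i
  have ep_mono: "ep i \<le> ep j" if "i \<le> j" for i j using that by (simp add: ep_def)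
  have ep_e: "e \<le> ep i" for i by (simp add: ep_def)
  let ?L = "\<lambda>i. link M d (ep i)"
  let ?C = "link M d e `` {x}"
  have "\<forall>i. \<exists>(m::nat) h K. 0 < m \<and> h 0 = id \<and>
    (\<forall>t<m. self_isometry M d (h t) \<and> (x, h t x) \<in> ?L (Suc i) \<and>
      (\<forall>c\<in>?L (Suc i) `` {x}. d (h t c) c \<le> K) \<and>
      (\<forall>s<m. (h s x, h t x) \<in> ?L i \<longrightarrow> s = t)) \<and>
    (\<forall>y\<in>?L (Suc i) `` {x}. \<exists>t<m. (h t x, y) \<in> ?L i)"
    by (intro allI shift_transversal[OF e ep_e ep_mono x]) simp
  from choice[OF this] obtain m :: "nat \<Rightarrow> nat" where "\<forall>i. \<exists>h K. 0 < m i \<and> h 0 = id \<and>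
    (\<forall>t<m i. self_isometry M d (h t) \<and> (x, h t x) \<in> ?L (Suc i) \<and>
      (\<forall>c\<in>?L (Suc i) `` {x}. d (h t c) c \<le> K) \<and>
      (\<forall>s<m i. (h s x, h t x) \<in> ?L i \<longrightarrow> s = t)) \<and>
    (\<forall>y\<in>?L (Suc i) `` {x}. \<exists>t<m i. (h t x, y) \<in> ?L i)" ..
  from choice[OF this] obtain h where "\<forall>i. \<exists>K. 0 < m i \<and> h i 0 = id \<and>
    (\<forall>t<m i. self_isometry M d (h i t) \<and> (x, h i t x) \<in> ?L (Suc i) \<and>
      (\<forall>c\<in>?L (Suc i) `` {x}. d (h i t c) c \<le> K) \<and>
      (\<forall>s<m i. (h i s x, h i t x) \<in> ?L i \<longrightarrow> s = t)) \<and>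
    (\<forall>y\<in>?L (Suc i) `` {x}. \<exists>t<m i. (h i t x, y) \<in> ?L i)" ..
  from choice[OF this] obtain K where mhK: "\<forall>i. 0 < m i \<and> h i 0 = id \<and>
    (\<forall>t<m i. self_isometry M d (h i t) \<and> (x, h i t x) \<in> ?L (Suc i) \<and>
      (\<forall>c\<in>?L (Suc i) `` {x}. d (h i t c) c \<le> K i) \<and>
      (\<forall>s<m i. (h i s x, h i t x) \<in> ?L i \<longrightarrow> s = t)) \<and>
    (\<forall>y\<in>?L (Suc i) `` {x}. \<exists>t<m i. (h i t x, y) \<in> ?L i)" ..
  have m: "0 < m i" and h0: "h i 0 = id"
    and ht: "\<forall>t<m i. self_isometry M d (h i t) \<and> (x, h i t x) \<in> ?L (Suc i) \<and>
      (\<forall>c\<in>?L (Suc i) `` {x}. d (h i t c) c \<le> K i) \<and>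
      (\<forall>s<m i. (h i s x, h i t x) \<in> ?L i \<longrightarrow> s = t)"
    and cov: "\<forall>y\<in>?L (Suc i) `` {x}. \<exists>t<m i. (h i t x, y) \<in> ?L i" for i
    by (insert spec[OF mhK, of i], elim conjE, assumption)+
  note hti = ht[THEN spec, THEN mp]
  note iso = hti[THEN conjunct1] and hx = hti[THEN conjunct2, THEN conjunct1]
    and disp' = hti[THEN conjunct2, THEN conjunct2, THEN conjunct1]
    and sep' = hti[THEN conjunct2, THEN conjunct2, THEN conjunct2]
  have disp: "d (h i t c) c \<le> K i" if "t < m i" "(x, c) \<in> ?L (Suc i)" for i t c
    using disp'[OF that(1)] that(2) by simp
  have sep: "s = t" if "t < m i" "s < m i" "(h i s x, h i t x) \<in> ?L i" for i s t
    using sep'[OF that(1)] that(2,3) by simp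
  have cover: "\<exists>t<m i. (h i t x, y) \<in> ?L i" if "(x, y) \<in> ?L (Suc i)" for i y
    using bspec[OF cov] that by simp
  have L_mono: "(a, b) \<in> ?L j" if "(a, b) \<in> ?L i" "i \<le> j" for i j a b
    using link_mono[OF ep_mono[OF that(2)], of M d] that(1) by blast
  have exhaust: "\<exists>i. (x, y) \<in> ?L i" if "y \<in> M" for y
  proof -
    have "d x y \<le> ep (nat \<lceil>d x y\<rceil>)" unfolding ep_def using e0 by linarith
    then show ?thesis using near_link[OF x that] by blast
  qed

  define N where "N i = (\<Prod>k<i. m k)" for i
  have N0: "N 0 = 1" and NS: "N (Suc i) = N i * m i" for i by (simp_all add: N_def)
  have Npos: "0 < N i" for i using m by (simp add: N_def prod_pos)
  \<comment> \<open>If only one component occurred at all levels from \<open>i\<close> on, the component of \<open>x\<close> at level \<open>i\<close> would be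
    everything, making the space large scale connected.\<close>
  have large: "\<exists>j\<ge>i. 2 \<le> m j" for i
  proof (rule ccontr)
    assume "\<not> ?thesis"
    then have m1: "m j = 1" if "i \<le> j" for j using m[of j] that by (metis One_nat_def Suc_leI le_antisym not_less_eq_eq numeral_2_eq_2)
    have down: "(x, y) \<in> ?L i" if "i \<le> j" "(x, y) \<in> ?L j" for j y
      using that
    proof (induction j arbitrary: y rule: dec_induct)
      case (step j)
      obtain t where "t < m j" "(h j t x, y) \<in> ?L j" using cover[OF step.prems] by blast
      then have "(x, y) \<in> ?L j" using m1[OF step.hyps(1)] h0[of j] by simp
      then show ?case by (rule step.IH)
    qed
    have "(x, y) \<in> ?L i" if y: "y \<in> M" for y
    proof -
      obtain j where "(x, y) \<in> ?L j" using exhaust[OF y] by blast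
      then have "(x, y) \<in> ?L (max i j)" by (rule L_mono) simp
      then show ?thesis by (rule down[rotated]) simp
    qed
    then have "\<forall>y\<in>M. \<forall>z\<in>M. (y, z) \<in> ?L i" by (meson link_sym rtrancl_trans)
    moreover have "0 \<le> ep i" using e0 by (simp add: ep_def)
    ultimately show False using nlsc unfolding large_scale_connected_iff by blast
  qed
  have unbounded: "\<exists>i. b \<le> N i" for b
  proof (induction b)
    case (Suc b)
    then obtain i where i: "b \<le> N i" by blast
    obtain j where j: "i \<le> j" "2 \<le> m j" using large by blast
    have "N i \<le> N j"
      using j(1) by (induction j rule: dec_induct) (use m NS in \<open>simp_all add: Suc_leI le_trans\<close>)
    moreover have "N j * 2 \<le> N (Suc j)" unfolding NS using j(2) by (rule mult_le_mono2)
    ultimately have "Suc b \<le> N (Suc j)" using i Npos[of j] by linarith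
    then show ?case by blast
  qed simp
  have N: "block_scale N"
    unfolding block_scale_def using N0 NS Npos unbounded by simp
  have N_mono: "N i \<le> N j" if "i \<le> j" for i j
    using block_scale_dvd[OF N that] Npos dvd_imp_le by blast

  define digit where "digit i z = z div N i mod m i" for i z
  have digit_less: "digit i z < m i" for i z using m by (simp add: digit_def)
  have div_digit: "z div N i = (z div N (Suc i)) * m i + digit i z" for i z
    by (simp add: digit_def NS div_mult2_eq)
  have digit_eq: "digit i z = digit i z'" if "n \<le> i" "z div N n = z' div N n" for i n z z'
    using div_eq_mono_dvd[OF block_scale_dvd[OF N that(1)] that(2)] by (simp add: digit_def)
  have div_eq: "z div N n = z' div N n"
    if "n \<le> i" "z < N i" "z' < N i" "\<And>k. n \<le> k \<Longrightarrow> k < i \<Longrightarrow> digit k z = digit k z'" for n i z z'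
    using that(1,4)
  proof (induction n rule: inc_induct)
    case base
    then show ?case using that(2,3) by simp
  next
    case (step n)
    then show ?case by (simp add: div_digit[of _ n])
  qed

  define H where "H i z = rec_nat id (\<lambda>i f. h i (digit i z) \<circ> f) i" for i z
  have H0: "H 0 z = id" and HS: "H (Suc i) z = h i (digit i z) \<circ> H i z" for i z
    by (simp_all add: H_def)
  have H_iso: "self_isometry M d (H i z)" for i z
    by (induction i) (simp_all only: H0 HS self_isometry_id self_isometry_comp iso digit_less)
  have CM: "c \<in> M" if "c \<in> ?C" for c using that link_class_subset[OF x] by blast
  have HM: "H i z c \<in> M" if "c \<in> ?C" for i z c using self_isometry_in[OF H_iso CM[OF that]] .
  have H_in: "(x, H i z c) \<in> ?L i" if c: "c \<in> ?C" for i z c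
  proof (induction i)
    case 0
    then show ?case using c by (simp add: H0 ep_def)
  next
    case (Suc i)
    have "(h i (digit i z) x, h i (digit i z) (H i z c)) \<in> ?L i"
      using Suc self_isometry_link_iff[OF iso[OF digit_less] x HM[OF c]] by blast
    then have "(h i (digit i z) x, H (Suc i) z c) \<in> ?L (Suc i)" by (simp add: HS L_mono)
    then show ?case using hx[OF digit_less] by (rule rtrancl_trans[rotated])
  qed
  have H_disp: "d (H i z c) c \<le> (\<Sum>k<i. K k)" if c: "c \<in> ?C" for i z c
  proof (induction i)
    case 0
    then show ?case using CM[OF c] by (simp add: H0)
  next
    case (Suc i)
    have "d (H (Suc i) z c) c \<le> d (h i (digit i z) (H i z c)) (H i z c) + d (H i z c) c"
      using triangle[OF HM[OF c, of "Suc i" z] HM[OF c, of i z] CM[OF c]] by (simp add: HS)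
    also have "d (h i (digit i z) (H i z c)) (H i z c) \<le> K i"
      by (rule disp[OF digit_less]) (rule L_mono[OF H_in[OF c]], simp)
    finally show ?case using Suc by simp
  qed
  have H_cong: "H i z = H i z'" if "\<And>k. k < i \<Longrightarrow> digit k z = digit k z'" for i z z'
    using that by (induction i) (simp_all add: H0 HS)
  have H_surj: "\<exists>z<N i. \<exists>c\<in>?C. H i z c = y" if "(x, y) \<in> ?L i" for i y
    using that
  proof (induction i arbitrary: y)
    case 0
    then show ?case by (intro exI[of _ 0]) (simp add: N0 H0 ep_def)
  next
    case (Suc i)
    obtain t where t: "t < m i" "(h i t x, y) \<in> ?L i" using cover[OF Suc.prems] by blast
    have "y \<in> M" using link_in[OF Suc.prems x] .
    then obtain y' where y': "y' \<in> M" "y = h i t y'" using self_isometry_surj[OF iso[OF t(1)]] by blast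
    then have "(x, y') \<in> ?L i" using t(2) self_isometry_link_iff[OF iso[OF t(1)] x y'(1)] by simp
    then obtain z c where z: "z < N i" "c \<in> ?C" "H i z c = y'" using Suc.IH by blast
    define w where "w = z + N i * t"
    have "w div N i = t" using z(1) by (simp add: w_def)
    then have dig: "digit i w = t" using t(1) by (simp add: digit_def)
    have "digit k w = digit k z" if "k < i" for k
    proof -
      have "N (Suc k) dvd N i" using that by (intro block_scale_dvd[OF N]) simp
      then obtain r where r: "N i = N k * (m k * r)" unfolding NS dvd_def mult.assoc by blast
      have "w div N k = z div N k + m k * r * t"
        unfolding w_def r using Npos[of k] by (simp add: mult.assoc)
      then show ?thesis by (simp add: digit_def mult.assoc)
    qed
    then have "H i w = H i z" by (rule H_cong)
    then have "H (Suc i) w c = y" using dig z y' by (simp add: HS)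
    moreover have "w < N (Suc i)"
    proof -
      have "w < N i * Suc t" using z(1) by (simp add: w_def)
      also have "\<dots> \<le> N (Suc i)" unfolding NS using t(1) by (intro mult_le_mono2) simp
      finally show ?thesis .
    qed
    ultimately show ?case using z(2) by blast
  qed
  have H_dist: "d (H i z c) (H i z' c') = d (H n z c) (H n z' c')"
    if "n \<le> i" "\<And>k. n \<le> k \<Longrightarrow> k < i \<Longrightarrow> digit k z = digit k z'" "c \<in> ?C" "c' \<in> ?C" for i n z z' c c'
    using that(1,2)
  proof (induction i rule: dec_induct)
    case (step i)
    have "digit i z = digit i z'" using step by simp
    then have "d (H (Suc i) z c) (H (Suc i) z' c') = d (H i z c) (H i z' c')"
      using iso[OF digit_less, of i z] HM[OF that(3)] HM[OF that(4)] by (simp add: HS self_isometry_def)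
    then show ?case using step by simp
  qed simp
  \<comment> \<open>The digit of the top place is read off from the component at that level; after cancelling
    the isometry belonging to it, the next digit can be compared.\<close>
  have H_sep: "digit k z = digit k z'"
    if "n \<le> k" "k < i" "(H i z c, H i z' c') \<in> ?L n" "c \<in> ?C" "c' \<in> ?C" for i k n z z' c c'
    using that(2,3)
  proof (induction i)
    case (Suc i)
    have ni: "n \<le> i" using Suc.prems(1) that(1) by simp
    let ?s = "digit i z" and ?t = "digit i z'"
    have near: "(h i ?s (H i z c), h i ?t (H i z' c')) \<in> ?L n" using Suc.prems by (simp add: HS)
    have "(h i ?s x, h i ?s (H i z c)) \<in> ?L i" "(h i ?t x, h i ?t (H i z' c')) \<in> ?L i"
      using self_isometry_link_iff[OF iso[OF digit_less] x HM] H_in that(4,5) by blast+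
    then have "(h i ?s x, h i ?t x) \<in> ?L i"
      using L_mono[OF near ni] link_sym by (meson rtrancl_trans)
    then have eq: "?s = ?t" using sep[OF digit_less digit_less] by blast
    then have "(H i z c, H i z' c') \<in> ?L n"
      using near self_isometry_link_iff[OF iso[OF digit_less] HM[OF that(4)] HM[OF that(5)]] by simp
    then show ?case using Suc.IH Suc.prems(1) eq by (cases "k = i") auto
  qed simp

  define R where "R = {((c, z), H i z c) | c z i. c \<in> ?C \<and> z < N i}"
  \<comment> \<open>Both points can be evaluated at a common level, as places beyond the length of
    \<open>z\<close> contribute the identity.\<close>
  have pairs: "\<exists>i\<ge>n. c \<in> ?C \<and> c' \<in> ?C \<and> z < N i \<and> z' < N i \<and> y = H i z c \<and> y' = H i z' c'"
    if in_R: "((c, z), y) \<in> R" "((c', z'), y') \<in> R" for c z y c' z' y' n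
  proof -
    obtain i i' where i: "c \<in> ?C" "z < N i" "y = H i z c" "c' \<in> ?C" "z' < N i'" "y' = H i' z' c'"
      using in_R by (auto simp: R_def)
    have stable: "H j z c = H i z c" if "z < N i" "i \<le> j" for i j z c
      using that(2)
    proof (induction j rule: dec_induct)
      case (step j)
      have "digit j z = 0" using that(1) N_mono[OF step.hyps(1)] by (simp add: digit_def)
      then show ?case using step h0 by (simp add: HS)
    qed simp
    define j where "j = max n (max i i')"
    have j: "n \<le> j" "i \<le> j" "i' \<le> j" by (simp_all add: j_def)
    have "z < N j" "z' < N j"
      using less_le_trans[OF i(2) N_mono[OF j(2)]] less_le_trans[OF i(5) N_mono[OF j(3)]] by simp_all
    moreover have "y = H j z c" "y' = H j z' c'"
      unfolding i(3,6) using stable[OF i(2) j(2)] stable[OF i(5) j(3)] by simp_all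
    ultimately show ?thesis using i(1,4) j(1) by blast
  qed
  have "Domain R = ?C \<times> UNIV"
  proof
    show "?C \<times> UNIV \<subseteq> Domain R"
    proof clarify
      fix c z assume c: "(x, c) \<in> link M d e"
      obtain i where "Suc z \<le> N i" using unbounded by blast
      then have "((c, z), H i z c) \<in> R" using c by (auto simp: R_def)
      then show "(c, z) \<in> Domain R" by blast
    qed
  qed (auto simp: R_def)
  moreover have "Range R = M"
  proof
    show "M \<subseteq> Range R"
    proof
      fix y assume "y \<in> M"
      then obtain i where "(x, y) \<in> ?L i" using exhaust by blast
      then obtain z c where "z < N i" "c \<in> ?C" "H i z c = y" using H_surj by blast
      then have "((c, z), y) \<in> R" by (auto simp: R_def)
      then show "y \<in> Range R" by blast
    qed
    show "Range R \<subseteq> M" using HM by (auto simp: R_def)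
  qed
  moreover have "controlled (max_dist d (block_dist N)) d R"
  proof (rule controlledI)
    fix \<delta> :: real
    define n where "n = nat \<lceil>\<delta>\<rceil>"
    have n: "\<delta> \<le> real n" unfolding n_def by linarith
    have "d y y' \<le> \<delta> + 2 * (\<Sum>k<n. K k)"
      if in_R: "((c, z), y) \<in> R" "((c', z'), y') \<in> R" "max_dist d (block_dist N) (c, z) (c', z') \<le> \<delta>"
      for c z y c' z' y'
    proof -
      obtain i where i: "n \<le> i" "c \<in> ?C" "c' \<in> ?C" "z < N i" "z' < N i" "y = H i z c" "y' = H i z' c'"
        using pairs[OF in_R(1,2)] by blast
      have dd: "d c c' \<le> \<delta>" "block_dist N z z' \<le> real n" using in_R(3) n by (auto simp: max_dist_def)
      then have "z div N n = z' div N n" using block_dist_le_iff[OF N] by blast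
      then have "d y y' = d (H n z c) (H n z' c')"
        unfolding i(6,7) using digit_eq by (intro H_dist[OF i(1) _ i(2,3)]) blast
      also have "\<dots> \<le> d (H n z c) c + (d c c' + d c' (H n z' c'))"
        using triangle[OF HM[OF i(2), of n z] CM[OF i(2)] HM[OF i(3), of n z']]
          triangle[OF CM[OF i(2)] CM[OF i(3)] HM[OF i(3), of n z']] by linarith
      finally show ?thesis
        using dd(1) H_disp[OF i(2), of n z] H_disp[OF i(3), of n z'] commute[of c' "H n z' c'"] by linarith
    qed
    then show "\<exists>\<eta>. \<forall>p y p' y'. (p, y) \<in> R \<longrightarrow> (p', y') \<in> R \<longrightarrow>
        max_dist d (block_dist N) p p' \<le> \<delta> \<longrightarrow> d y y' \<le> \<eta>"
      by (intro exI[of _ "\<delta> + 2 * (\<Sum>k<n. K k)"]) auto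
  qed
  moreover have "controlled d (max_dist d (block_dist N)) (R\<inverse>)"
  proof (rule controlledI)
    fix \<delta> :: real
    define n where "n = nat \<lceil>\<delta>\<rceil>"
    have n: "\<delta> \<le> ep n" unfolding n_def ep_def using e0 by linarith
    have "max_dist d (block_dist N) (c, z) (c', z') \<le> max (\<delta> + 2 * (\<Sum>k<n. K k)) (real n)"
      if in_R: "((c, z), y) \<in> R" "((c', z'), y') \<in> R" "d y y' \<le> \<delta>" for c z y c' z' y'
    proof -
      obtain i where i: "n \<le> i" "c \<in> ?C" "c' \<in> ?C" "z < N i" "z' < N i" "y = H i z c" "y' = H i z' c'"
        using pairs[OF in_R(1,2)] by blast
      have "(H i z c, H i z' c') \<in> ?L n"
        using HM[OF i(2), of i z] HM[OF i(3), of i z'] in_R(3) n unfolding i(6,7)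
        by (intro near_link) auto
      then have dig: "digit k z = digit k z'" if "n \<le> k" "k < i" for k
        using H_sep[OF that _ i(2,3)] by blast
      then have "z div N n = z' div N n" by (rule div_eq[OF i(1,4,5)])
      then have bd: "block_dist N z z' \<le> real n" using block_dist_le_iff[OF N] by blast
      have "d y y' = d (H n z c) (H n z' c')"
        unfolding i(6,7) by (rule H_dist[OF i(1) dig i(2,3)])
      moreover have "d c c' \<le> d c (H n z c) + (d (H n z c) (H n z' c') + d (H n z' c') c')"
        using triangle[OF CM[OF i(2)] HM[OF i(2), of n z] CM[OF i(3)]]
          triangle[OF HM[OF i(2), of n z] HM[OF i(3), of n z'] CM[OF i(3)]] by linarith
      ultimately have "d c c' \<le> \<delta> + 2 * (\<Sum>k<n. K k)"
        using in_R(3) H_disp[OF i(2), of n z] H_disp[OF i(3), of n z'] commute[of c "H n z c"] by linarith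
      then show ?thesis using bd by (simp add: max_dist_def max.coboundedI1 max.coboundedI2)
    qed
    then show "\<exists>\<eta>. \<forall>y p y' p'. (y, p) \<in> R\<inverse> \<longrightarrow> (y', p') \<in> R\<inverse> \<longrightarrow> d y y' \<le> \<delta> \<longrightarrow>
        max_dist d (block_dist N) p p' \<le> \<eta>"
      by (intro exI[of _ "max (\<delta> + 2 * (\<Sum>k<n. K k)) (real n)"]) auto
  qed
  ultimately have "coarse_correspondence (?C \<times> UNIV) (max_dist d (block_dist N)) M d R"
    by (simp add: coarse_correspondence_def)
  then show ?thesis using N by (auto simp: corresponding_def)
qed

section \<open>The classification\<close>

theorem theorem1p3:
  fixes X :: "'a set" and dX :: "'a \<Rightarrow> 'a \<Rightarrow> real"
    and Y :: "'b set" and dY :: "'b \<Rightarrow> 'b \<Rightarrow> real"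
    and C :: "'a set" and D :: "'b set"
  assumes "Metric_space X dX" and "X \<noteq> {}"
    and "Metric_space Y dY" and "Y \<noteq> {}"
    and "shift_homogeneous X dX" and "boundedly_finite X dX"
    and "shift_homogeneous Y dY" and "boundedly_finite Y dY"
    and "factorizing_component X dX C" and "factorizing_component Y dY D"
  shows "coarsely_equivalent X dX Y dY \<longleftrightarrow>
    coarsely_equivalent C dX D dY \<and>
    ((large_scale_connected dX X \<and> large_scale_connected dY Y) \<or>
     (\<not> large_scale_connected dX X \<and> \<not> large_scale_connected dY Y))"
proof -
  interpret X: shift_space X dX
    using assms by (simp add: shift_space_def shift_space_axioms_def)
  interpret Y: shift_space Y dY
    using assms by (simp add: shift_space_def shift_space_axioms_def)
  note Xm = X.Metric_space_axioms and Ym = Y.Metric_space_axioms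
  have C: "(\<forall>e. \<not> factorizes X dX e) \<and> C = X \<or>
      (\<exists>e x. factorizes X dX e \<and> x \<in> X \<and> C = link X dX e `` {x})"
    by (rule X.factorizing_component_cases[OF assms(6,9)]) blast+
  have D: "(\<forall>e. \<not> factorizes Y dY e) \<and> D = Y \<or>
      (\<exists>e y. factorizes Y dY e \<and> y \<in> Y \<and> D = link Y dY e `` {y})"
    by (rule Y.factorizing_component_cases[OF assms(8,10)]) blast+
  have "C \<subseteq> X" using C by (elim disjE exE conjE) (simp_all add: link_class_subset)
  then have Cm: "Metric_space C dX" by (rule X.subspace)
  have "D \<subseteq> Y" using D by (elim disjE exE conjE) (simp_all add: link_class_subset)
  then have Dm: "Metric_space D dY" by (rule Y.subspace)
  have lscC: "large_scale_connected dX C" if "factorizes X dX e" for e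
    using C
  proof (elim disjE conjE exE)
    fix e x assume "factorizes X dX e" "x \<in> X" "C = link X dX e `` {x}"
    then show ?thesis using X.large_scale_connected_component by (simp add: factorizes_def)
  qed (use that in blast)
  have lscD: "large_scale_connected dY D" if "factorizes Y dY e" for e
    using D
  proof (elim disjE conjE exE)
    fix e y assume "factorizes Y dY e" "y \<in> Y" "D = link Y dY e `` {y}"
    then show ?thesis using Y.large_scale_connected_component by (simp add: factorizes_def)
  qed (use that in blast)
  have "corresponding X dX Y dY \<longleftrightarrow> corresponding C dX D dY \<and>
      (large_scale_connected dX X \<longleftrightarrow> large_scale_connected dY Y)" (is "?L \<longleftrightarrow> ?R")
  proof
    assume XY: ?L
    then obtain R where R: "coarse_correspondence X dX Y dY R" by (auto simp: corresponding_def)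
    have RY: "coarse_correspondence Y dY X dX (R\<inverse>)" using R by (auto simp: coarse_correspondence_def)
    have "corresponding C dX D dY"
      using C
    proof (elim disjE conjE exE)
      fix e x assume e: "factorizes X dX e" "x \<in> X" "C = link X dX e `` {x}"
      obtain e' y where e': "factorizes Y dY e'" "y \<in> Y" "corresponding C dX (link Y dY e' `` {y}) dY"
        using X.component_transfer[OF Ym R e(1,2)] unfolding e(3) by blast
      then obtain f w where f: "factorizes Y dY f" "w \<in> Y" "D = link Y dY f `` {w}" using D by blast
      then show ?thesis
        using corresponding_trans[OF e'(3) Y.components_corresponding[OF e'(1) f(1) e'(2) f(2)]] by simp
    next
      assume no: "\<forall>e. \<not> factorizes X dX e" and CX: "C = X"
      have "\<not> factorizes Y dY e" for e
      proof
        assume e: "factorizes Y dY e"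
        obtain y where "y \<in> Y" using assms(4) by blast
        from Y.component_transfer[OF Xm RY e this] show False using no by blast
      qed
      then have "D = Y" using D by blast
      then show ?thesis using XY CX by simp
    qed
    moreover have "large_scale_connected dX X \<longleftrightarrow> large_scale_connected dY Y"
      using large_scale_connected_transfer[OF Xm XY]
        large_scale_connected_transfer[OF Ym corresponding_sym[OF XY]] by blast
    ultimately show ?R by blast
  next
    assume R: ?R
    then have CD: "corresponding C dX D dY" by blast
    show ?L
    proof (cases "large_scale_connected dX X")
      case True
      then have lY: "large_scale_connected dY Y" using R by blast
      have "\<exists>e x. factorizes X dX e \<and> x \<in> X \<and> C = link X dX e `` {x}"
        using C X.large_scale_connected_factorizes[OF True] by blast
      then have CX: "corresponding C dX X dX" using X.component_corresponding_whole[OF True] by blast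
      have "\<exists>e y. factorizes Y dY e \<and> y \<in> Y \<and> D = link Y dY e `` {y}"
        using D Y.large_scale_connected_factorizes[OF lY] by blast
      then have "corresponding D dY Y dY" using Y.component_corresponding_whole[OF lY] by blast
      from corresponding_trans[OF corresponding_sym[OF CX] corresponding_trans[OF CD this]] show ?thesis .
    next
      case False
      then have nY: "\<not> large_scale_connected dY Y" using R by blast
      have lCD: "large_scale_connected dX C \<longleftrightarrow> large_scale_connected dY D"
        using large_scale_connected_transfer[OF Cm CD]
          large_scale_connected_transfer[OF Dm corresponding_sym[OF CD]] by blast
      show ?thesis
        using C
      proof (elim disjE conjE exE)
        assume no: "\<forall>e. \<not> factorizes X dX e" and CX: "C = X"
        have "\<not> factorizes Y dY e" for e using lscD[of e] lCD False CX by blast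
        then have "D = Y" using D by blast
        then show ?thesis using CD CX by simp
      next
        fix e x assume e: "factorizes X dX e" "x \<in> X" "C = link X dX e `` {x}"
        \<comment> \<open>The factorizing component of \<open>X\<close> is large scale connected, hence so is \<open>D\<close>, unlike \<open>Y\<close>.\<close>
        have "D \<noteq> Y" using lscC[OF e(1)] lCD nY by blast
        then obtain f y where f: "factorizes Y dY f" "y \<in> Y" "D = link Y dY f `` {y}" using D by blast
        obtain N where N: "block_scale N" "corresponding (C \<times> UNIV) (max_dist dX (block_dist N)) X dX"
          using X.product_decomposition[OF False e(1,2)] e(3) by blast
        obtain N' where N': "block_scale N'" "corresponding (D \<times> UNIV) (max_dist dY (block_dist N')) Y dY"
          using Y.product_decomposition[OF nY f(1,2)] f(3) by blast
        have "corresponding (C \<times> UNIV) (max_dist dX (block_dist N)) (D \<times> UNIV) (max_dist dY (block_dist N'))"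
          by (rule corresponding_times[OF CD block_scales_corresponding[OF N(1) N'(1)]])
        from corresponding_trans[OF corresponding_sym[OF N(2)] corresponding_trans[OF this N'(2)]]
        show ?thesis .
      qed
    qed
  qed
  moreover have "coarsely_equivalent X dX Y dY \<longleftrightarrow> corresponding X dX Y dY"
    using corresponding_if_coarsely_equivalent[OF Xm Ym] coarsely_equivalent_if_corresponding[OF Xm Ym] by blast
  moreover have "coarsely_equivalent C dX D dY \<longleftrightarrow> corresponding C dX D dY"
    using corresponding_if_coarsely_equivalent[OF Cm Dm] coarsely_equivalent_if_corresponding[OF Cm Dm] by blast
  ultimately show ?thesis by blast
qed

end
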